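(* For $\alpha\in[0,1]$ let $\nu_\alpha$ be the probability measure on $\mathbb{R}_+$ defined on Stern-Brocot intervals as in the context, and let $\gamma(\alpha):=\int_0^\infty\log x\,d\nu_\alpha(x)$. Then for all $1/2<\alpha\le1$, $$\gamma'(\alpha)=\gamma(\alpha)\,\frac{1+2\alpha-2\alpha^2}{(2\alpha-1)(\alpha^2-\alpha+1)}+\frac{2\alpha-1}{\alpha^2-\alpha+1}\int_0^\infty\!\!\int_0^\infty\log\frac{x+y+xy}{x+y+1}\;\nu_\alpha\otimes\nu_\alpha(dx,dy),$$ where $\gamma'$ is the derivative of $\gamma$ with respect to $\alpha$ (the left derivative at the endpoint $\alpha=1$).
   Context: Positive Stern-Brocot intervals are defined inductively, with the convention $\frac10=+\infty$. The only Stern-Brocot interval of rank $0$ is $[\frac01,\frac10]=[0,\infty]$. Each Stern-Brocot interval $[\frac ab,\frac cd]$ of rank $r$ is cut into two Stern-Brocot intervals of rank $r+1$: the left one $[\frac ab,\frac{a+c}{b+d}]$ and the right one $[\frac{a+c}{b+d},\frac cd]$. For $\alpha\in[0,1]$, $\nu_\alpha$ is the Borel probability measure on $\mathbb{R}_+$ defined inductively on Stern-Brocot intervals: first assign mass $1-\alpha$ to $[0,1]$ and mass $\alpha$ to $[1,\infty]$ (rank $1$). Once $\nu_\alpha$ is defined on a Stern-Brocot interval of rank $r\ge1$, a proportion $\alpha$ of its mass is given to its left subinterval of rank $r+1$ if $r$ is odd, and to its right subinterval of rank $r+1$ if $r$ is even; the other subinterval receives the remaining proportion $1-\alpha$. 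*)

theory Defs
  imports "HOL-Probability.Probability"
begin

text \<open>
  \<open>SB_interval r a b c d\<close> says that \<open>[a/b, c/d]\<close> is a Stern-Brocot interval of rank \<open>r\<close>,
  where the fraction \<open>1/0\<close> stands for \<open>+\<infinity>\<close>.
\<close>

inductive SB_interval :: "nat \<Rightarrow> nat \<Rightarrow> nat \<Rightarrow> nat \<Rightarrow> nat \<Rightarrow> bool" where
  root: "SB_interval 0 0 1 1 0"
| left: "SB_interval r a b c d \<Longrightarrow> SB_interval (Suc r) a b (a + c) (b + d)"
| right: "SB_interval r a b c d \<Longrightarrow> SB_interval (Suc r) (a + c) (b + d) c d"

text \<open>
  The real points of \<open>[a/b, c/d]\<close>. The left denominator \<open>b\<close> of a Stern-Brocot interval is never
  zero, and \<open>d = 0\<close> means that the interval is unbounded to the right. The point at infinity is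
  left out, since the measures below live on the real line.
\<close>

definition SB_set :: "nat \<Rightarrow> nat \<Rightarrow> nat \<Rightarrow> nat \<Rightarrow> real set" where
  "SB_set a b c d = {x. real a / real b \<le> x \<and> (d = 0 \<or> x \<le> real c / real d)}"

text \<open>
  A measure on the nonnegative reals is represented by a Borel measure on \<open>real\<close> that gives full
  mass to the rank \<open>0\<close> interval \<open>{0..}\<close>.
\<close>

definition is_nu :: "real \<Rightarrow> real measure \<Rightarrow> bool" where
  "is_nu \<alpha> M \<longleftrightarrow>
     prob_space M \<and> sets M = sets borel \<and>
     measure M (SB_set 0 1 1 0) = 1 \<and>
     measure M (SB_set 0 1 1 1) = 1 - \<alpha> \<and>
     measure M (SB_set 1 1 1 0) = \<alpha> \<and>
     (\<forall>r a b c d. r \<ge> 1 \<longrightarrow> SB_interval r a b c d \<longrightarrow>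
        measure M (SB_set a b (a + c) (b + d)) =
          (if odd r then \<alpha> else 1 - \<alpha>) * measure M (SB_set a b c d) \<and>
        measure M (SB_set (a + c) (b + d) c d) =
          (if odd r then 1 - \<alpha> else \<alpha>) * measure M (SB_set a b c d))"

text \<open>
  For \<open>\<alpha>\<close> in \<open>{0..1}\<close> there is exactly one such measure; for other \<open>\<alpha>\<close> there is none and
  \<open>nu \<alpha>\<close> is unspecified.
\<close>

definition nu :: "real \<Rightarrow> real measure" where
  "nu \<alpha> = (THE M. is_nu \<alpha> M)"

definition gamma :: "real \<Rightarrow> real" where
  "gamma \<alpha> = (\<integral>x. ln x \<partial>nu \<alpha>)"

end

theory Submission
  imports Defs
begin

text \<open>
  Conjugating by \<open>x \<mapsto> 1/x\<close> exchanges left and right subintervals, so \<open>nu \<alpha>\<close> is the stationary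
  law of the Markov chain that moves from \<open>x\<close> to \<open>1 + 1/x\<close> with probability \<open>\<alpha>\<close> and to
  \<open>1/(1+x)\<close> with probability \<open>1 - \<alpha>\<close>. Applied to \<open>ln\<close>, stationarity gives
  \<open>(1 + \<alpha>) \<gamma>(\<alpha>) = (2\<alpha> - 1) L(\<alpha>)\<close> with \<open>L(\<alpha>) = \<integral> ln (1 + x) dnu \<alpha>\<close>. Applied to the
  symmetric kernel \<open>ln (1 + x y)\<close>, once in \<open>x\<close> with law \<open>nu \<beta>\<close> and once in \<open>y\<close> with law
  \<open>nu \<alpha>\<close>, it shows that \<open>F(\<alpha>) = \<alpha> \<gamma>(\<alpha>) + (1 - \<alpha>) L(\<alpha>)\<close> satisfies the exact identity
  \<open>F(\<beta>) - F(\<alpha>) = (\<beta> - \<alpha>) \<integral>\<integral> ln ((x + y + x y) / (x + y + 1)) nu \<beta>(dx) nu \<alpha>(dy)\<close>.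
  Weak continuity of \<open>nu\<close> turns it into the derivative of \<open>F\<close>, and
  \<open>\<gamma>(\<alpha>) = F(\<alpha>) (2\<alpha> - 1) / (\<alpha>\<^sup>2 - \<alpha> + 1)\<close>.
\<close>

subsection \<open>Existence of a stationary law\<close>

text \<open>\<open>step True\<close> and \<open>step False\<close> are \<open>x \<mapsto> 1 + 1/x\<close> and \<open>x \<mapsto> 1/(1+x)\<close> in the coordinate
  \<open>t = x/(1+x)\<close>, where they extend continuously to \<open>[0,1]\<close> and contract.\<close>

definition step :: "bool \<Rightarrow> real \<Rightarrow> real" where
  "step b t = (if b then 1 / (1 + t) else (1 - t) / (2 - t))"

lemma step_mem: "t \<in> {0..1} \<Longrightarrow> step b t \<in> {0..1}"
  by (auto simp: step_def divide_simps)

lemma step_measurable [measurable]: "step b \<in> borel_measurable borel"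
  unfolding step_def by measurable

text \<open>Both maps are Moebius maps of determinant -1, so the difference is \<open>t - s\<close>
  over the product of the two denominators, and that product is at least
  \<open>1 + \<bar>s - t\<bar>\<close>. No constant factor below 1 would do: the slope is -1 at
  \<open>t = 0\<close> for \<open>step True\<close> and at \<open>t = 1\<close> for
  \<open>step False\<close>.\<close>

lemma step_diff:
  assumes "s \<in> {0..1}" "t \<in> {0..1}"
  shows "\<bar>step b s - step b t\<bar> \<le> \<bar>s - t\<bar> / (1 + \<bar>s - t\<bar>)"
proof (cases b)
  case True
  have eq: "1 / (1 + s) - 1 / (1 + t) = (t - s) / ((1 + s) * (1 + t))"
    using assms by (simp add: field_simps)
  have "1 + \<bar>s - t\<bar> \<le> (1 + s) * (1 + t)"
    using assms mult_nonneg_nonneg[of s t] by (auto simp: algebra_simps abs_if)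
  then show ?thesis
    using True assms unfolding step_def
    by (simp add: eq abs_mult abs_minus_commute frac_le)
next
  case False
  have eq: "(1 - s) / (2 - s) - (1 - t) / (2 - t) = (t - s) / ((2 - s) * (2 - t))"
    using assms by (simp add: field_simps)
  have "1 + \<bar>s - t\<bar> \<le> (2 - s) * (2 - t)"
    using assms mult_nonneg_nonneg[of "1 - s" "1 - t"] by (auto simp: algebra_simps abs_if)
  then show ?thesis
    using False assms unfolding step_def
    by (simp add: eq abs_mult abs_minus_commute frac_le)
qed

text \<open>The function \<open>d / (1 + d)\<close> is increasing in \<open>d\<close> and sends
  \<open>1/(n+1)\<close> to \<open>1/(n+2)\<close>, so distances are controlled by a harmonic rate
  instead of a geometric one.\<close>

lemma step_contract:
  assumes "s \<in> {0..1}" "t \<in> {0..1}" "\<bar>s - t\<bar> \<le> 1 / real (Suc n)"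
  shows "\<bar>step b s - step b t\<bar> \<le> 1 / real (Suc (Suc n))"
proof -
  have "d / (1 + d) \<le> 1 / real (Suc (Suc n))" if "0 \<le> d" "d \<le> 1 / real (Suc n)" for d
    using that by (simp add: divide_simps) (simp add: algebra_simps)
  from this[OF _ assms(3)]
  have "\<bar>s - t\<bar> / (1 + \<bar>s - t\<bar>) \<le> 1 / real (Suc (Suc n))" by simp
  with step_diff[OF assms(1,2)] show ?thesis by (rule order_trans)
qed

lemma continuous_on_step: "continuous_on {0..1} (step b)"
  unfolding step_def by (cases b) (auto intro!: continuous_intros)

text \<open>The first coin gives the outermost map and the starting value sits innermost. In this
  order the values converge for every stream; adding new maps on the outside would give a chain that
  in general keeps moving.\<close>

primrec convergent_at :: "nat \<Rightarrow> bool stream \<Rightarrow> real" where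
  "convergent_at 0 \<omega> = 0"
| "convergent_at (Suc n) \<omega> = step (shd \<omega>) (convergent_at n (stl \<omega>))"

lemma convergent_at_mem: "convergent_at n \<omega> \<in> {0..1}"
  by (induction n arbitrary: \<omega>) (auto simp del: atLeastAtMost_iff intro: step_mem, simp)

text \<open>The two values share their \<open>n\<close> outermost maps. The points inside are at
  distance at most 1, and each shared map improves \<open>1/m\<close> to
  \<open>1/(m+1)\<close>.\<close>

lemma convergent_at_diff: "\<bar>convergent_at (n + k) \<omega> - convergent_at n \<omega>\<bar> \<le> 1 / real (Suc n)"
proof (induction n arbitrary: \<omega>)
  case 0
  then show ?case using convergent_at_mem[of k \<omega>] by auto
next
  case (Suc n)
  show ?case
    using step_contract[OF convergent_at_mem convergent_at_mem Suc.IH[of "stl \<omega>"], of "shd \<omega>"]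
    by simp
qed

lemma Cauchy_convergent_at: "Cauchy (\<lambda>n. convergent_at n \<omega>)"
proof (rule metric_CauchyI)
  fix e :: real assume "e > 0"
  then obtain N where N: "1 / real (Suc N) < e / 2"
    using nat_approx_posE[of "e / 2"] by auto
  have *: "\<bar>convergent_at m \<omega> - convergent_at N \<omega>\<bar> < e / 2" if "m \<ge> N" for m
    using convergent_at_diff[of N "m - N" \<omega>] N that by simp
  show "\<exists>M. \<forall>m\<ge>M. \<forall>n\<ge>M. dist (convergent_at m \<omega>) (convergent_at n \<omega>) < e"
  proof (intro exI allI impI)
    fix m n assume "N \<le> m" "N \<le> n"
    then show "dist (convergent_at m \<omega>) (convergent_at n \<omega>) < e"
      using *[of m] *[of n] unfolding dist_real_def by argo
  qed
qed

definition limit_point :: "bool stream \<Rightarrow> real" where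
  "limit_point \<omega> = lim (\<lambda>n. convergent_at n \<omega>)"

lemma limit_point_LIMSEQ: "(\<lambda>n. convergent_at n \<omega>) \<longlonglongrightarrow> limit_point \<omega>"
  unfolding limit_point_def
  using Cauchy_convergent_at Cauchy_convergent_iff convergent_LIMSEQ_iff by blast

lemma limit_point_mem: "limit_point \<omega> \<in> {0..1}"
  using closed_sequentially[of "{0..1::real}", OF _ convergent_at_mem limit_point_LIMSEQ] by simp

lemma limit_point_SCons: "limit_point (b ## \<omega>) = step b (limit_point \<omega>)"
proof (rule LIMSEQ_unique)
  show "(\<lambda>n. convergent_at (Suc n) (b ## \<omega>)) \<longlonglongrightarrow> limit_point (b ## \<omega>)"
    by (rule LIMSEQ_Suc[OF limit_point_LIMSEQ])
  show "(\<lambda>n. convergent_at (Suc n) (b ## \<omega>)) \<longlonglongrightarrow> step b (limit_point \<omega>)"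
    using continuous_on_tendsto_compose[OF continuous_on_step limit_point_LIMSEQ limit_point_mem]
      convergent_at_mem by simp
qed

lemma convergent_at_measurable [measurable]:
  "convergent_at n \<in> borel_measurable (stream_space (measure_pmf p))"
proof (induction n)
  case 0
  show ?case by simp
next
  case (Suc n)
  note Suc [measurable]
  have *: "convergent_at (Suc n) =
      (\<lambda>\<omega>. if shd \<omega> then step True (convergent_at n (stl \<omega>)) else step False (convergent_at n (stl \<omega>)))"
    by (auto simp: fun_eq_iff)
  have [measurable]: "Measurable.pred (stream_space (measure_pmf p)) shd"
    using measurable_shd[of "measure_pmf p"] by (simp add: pred_def measurable_def)
  show ?case unfolding * by measurable
qed

lemma limit_point_measurable [measurable]:
  "limit_point \<in> borel_measurable (stream_space (measure_pmf p))"
  by (rule borel_measurable_LIMSEQ_metric[of convergent_at]) (auto intro: limit_point_LIMSEQ)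

abbreviation coins :: "real \<Rightarrow> bool stream measure" where
  "coins \<alpha> \<equiv> stream_space (measure_pmf (bernoulli_pmf \<alpha>))"

text \<open>The first coin is independent of the others, which again form a stream of the same law.
  Together with \<open>limit_point_SCons\<close> this makes the law of \<open>limit_point\<close>
  invariant under the random step.\<close>

lemma nn_integral_limit_point:
  assumes \<alpha>: "0 \<le> \<alpha>" "\<alpha> \<le> 1" and [measurable]: "f \<in> borel_measurable borel"
  shows "(\<integral>\<^sup>+\<omega>. f (limit_point \<omega>) \<partial>coins \<alpha>) =
    ennreal \<alpha> * (\<integral>\<^sup>+\<omega>. f (step True (limit_point \<omega>)) \<partial>coins \<alpha>) +
    ennreal (1 - \<alpha>) * (\<integral>\<^sup>+\<omega>. f (step False (limit_point \<omega>)) \<partial>coins \<alpha>)"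
proof -
  have "(\<integral>\<^sup>+\<omega>. f (limit_point \<omega>) \<partial>coins \<alpha>) =
    (\<integral>\<^sup>+b. \<integral>\<^sup>+\<omega>. f (limit_point (b ## \<omega>)) \<partial>coins \<alpha> \<partial>bernoulli_pmf \<alpha>)"
    by (rule prob_space.nn_integral_stream_space) (auto intro: measure_pmf.prob_space_axioms)
  then show ?thesis using \<alpha> by (simp add: limit_point_SCons mult.commute)
qed

lemma prob_space_coins: "prob_space (coins \<alpha>)"
  by (rule prob_space.prob_space_stream_space) (rule measure_pmf.prob_space_axioms)

text \<open>The endpoints stand for \<open>x = 0\<close> and \<open>x = \<infinity>\<close>. The
  point 1 is reached only from 0 by \<open>step True\<close>, and 0 only from 1 by
  \<open>step False\<close>, so the two atoms satisfy a linear system whose determinant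
  \<open>1 - \<alpha> * (1 - \<alpha>)\<close> is positive.\<close>

lemma AE_limit_point:
  assumes \<alpha>: "0 \<le> \<alpha>" "\<alpha> \<le> 1"
  shows "AE \<omega> in coins \<alpha>. 0 < limit_point \<omega> \<and> limit_point \<omega> < 1"
proof -
  interpret S: prob_space "coins \<alpha>" by (rule prob_space_coins)
  define p where "p c = emeasure (coins \<alpha>) {\<omega> \<in> space (coins \<alpha>). limit_point \<omega> = c}" for c
  have p_nn: "p c = (\<integral>\<^sup>+\<omega>. indicator {c} (limit_point \<omega>) \<partial>coins \<alpha>)" for c
    unfolding p_def
    by (subst nn_integral_indicator[symmetric])
      (auto intro!: nn_integral_cong split: split_indicator simp del: nn_integral_indicator)
  have s1: "indicator {1} (step True t) = (indicator {0} t :: ennreal)"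
    "indicator {1} (step False t) = (0 :: ennreal)"
    "indicator {0} (step True t) = (0 :: ennreal)"
    "indicator {0} (step False t) = (indicator {1} t :: ennreal)" if "t \<in> {0..1}" for t
    using that by (auto simp: step_def indicator_def divide_simps)
  have p1: "p 1 = ennreal \<alpha> * p 0"
    unfolding p_nn by (subst nn_integral_limit_point[OF \<alpha>]) (simp_all add: s1 limit_point_mem del: atLeastAtMost_iff)
  have p0: "p 0 = ennreal (1 - \<alpha>) * p 1"
    unfolding p_nn by (subst nn_integral_limit_point[OF \<alpha>]) (simp_all add: s1 limit_point_mem del: atLeastAtMost_iff)
  define q where "q c = measure (coins \<alpha>) {\<omega> \<in> space (coins \<alpha>). limit_point \<omega> = c}" for c
  have pq: "p c = ennreal (q c)" for c unfolding p_def q_def by (simp add: S.emeasure_eq_measure)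
  have q_nn: "q c \<ge> 0" for c by (simp add: q_def)
  have q1: "q 1 = \<alpha> * q 0"
    using p1 \<alpha> by (simp add: pq q_nn ennreal_mult[symmetric])
  have q0: "q 0 = (1 - \<alpha>) * q 1"
    using p0 \<alpha> by (simp add: pq q_nn ennreal_mult[symmetric])
  have "q 1 * (1 - \<alpha> * (1 - \<alpha>)) = 0" using q1 q0 by (simp add: algebra_simps)
  moreover have "\<alpha> * (1 - \<alpha>) \<le> 1 / 4"
    using zero_le_power2[of "\<alpha> - 1 / 2"] by (simp add: power2_eq_square algebra_simps)
  ultimately have "q 1 = 0" by auto
  with q0 have "q 0 = 0" by simp
  have *: "AE \<omega> in coins \<alpha>. limit_point \<omega> \<noteq> c" if "q c = 0" for c
    by (rule AE_I[where N = "{\<omega> \<in> space (coins \<alpha>). limit_point \<omega> = c}"])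
      (use that in \<open>auto simp: q_def S.emeasure_eq_measure\<close>)
  show ?thesis using *[OF \<open>q 0 = 0\<close>] *[OF \<open>q 1 = 0\<close>]
  proof eventually_elim
    case (elim \<omega>)
    then show ?case using limit_point_mem[of \<omega>] by auto
  qed
qed

section \<open>Stationary laws on the half-line and their integral identities\<close>

locale stationary_law = prob_space M for M :: "real measure" +
  fixes \<alpha> :: real
  assumes \<alpha>: "0 \<le> \<alpha>" "\<alpha> \<le> 1"
    and sets_M [measurable_cong]: "sets M = sets borel"
    and AE_pos: "AE x in M. 0 < x"
    and nn_integral_split: "\<And>f. f \<in> borel_measurable borel \<Longrightarrow>
      (\<integral>\<^sup>+x. f x \<partial>M) = ennreal \<alpha> * (\<integral>\<^sup>+x. f (1 + 1 / x) \<partial>M) +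
        ennreal (1 - \<alpha>) * (\<integral>\<^sup>+x. f (1 / (1 + x)) \<partial>M)"

text \<open>The map \<open>t / (1 - t)\<close> inverts \<open>x / (1 + x)\<close> and conjugates
  \<open>step\<close> to the two maps of the half-line. The totalised divisions at
  \<open>t = 0\<close> and \<open>t = 1\<close> are harmless because \<open>AE_limit_point\<close>
  excludes these points.\<close>

lemma stationary_law_exists:
  assumes \<alpha>: "0 \<le> \<alpha>" "\<alpha> \<le> 1"
  shows "stationary_law (distr (coins \<alpha>) borel (\<lambda>\<omega>. limit_point \<omega> / (1 - limit_point \<omega>))) \<alpha>"
proof -
  interpret S: prob_space "coins \<alpha>" by (rule prob_space_coins)
  let ?X = "\<lambda>\<omega>. limit_point \<omega> / (1 - limit_point \<omega>)"
  interpret D: prob_space "distr (coins \<alpha>) borel ?X" by (rule S.prob_space_distr) measurable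
  show ?thesis
  proof
    show "AE x in distr (coins \<alpha>) borel ?X. 0 < x"
      using AE_limit_point[OF \<alpha>] by (subst AE_distr_iff) (auto elim: eventually_mono)
  next
    fix f :: "real \<Rightarrow> ennreal" assume f [measurable]: "f \<in> borel_measurable borel"
    have "(\<integral>\<^sup>+\<omega>. f (step True (limit_point \<omega>) / (1 - step True (limit_point \<omega>))) \<partial>coins \<alpha>)
        = (\<integral>\<^sup>+\<omega>. f (1 + 1 / ?X \<omega>) \<partial>coins \<alpha>)"
      using AE_limit_point[OF \<alpha>]
      by (intro nn_integral_cong_AE, eventually_elim)
        (auto simp: step_def field_simps intro!: arg_cong[where f = f])
    moreover have "(\<integral>\<^sup>+\<omega>. f (step False (limit_point \<omega>) / (1 - step False (limit_point \<omega>))) \<partial>coins \<alpha>)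
        = (\<integral>\<^sup>+\<omega>. f (1 / (1 + ?X \<omega>)) \<partial>coins \<alpha>)"
      using AE_limit_point[OF \<alpha>]
      by (intro nn_integral_cong_AE, eventually_elim)
        (auto simp: step_def field_simps intro!: arg_cong[where f = f])
    ultimately show "(\<integral>\<^sup>+x. f x \<partial>distr (coins \<alpha>) borel ?X) =
        ennreal \<alpha> * (\<integral>\<^sup>+x. f (1 + 1 / x) \<partial>distr (coins \<alpha>) borel ?X) +
        ennreal (1 - \<alpha>) * (\<integral>\<^sup>+x. f (1 / (1 + x)) \<partial>distr (coins \<alpha>) borel ?X)"
      using nn_integral_limit_point[OF \<alpha>, of "\<lambda>t. f (t / (1 - t))"]
      by (simp add: nn_integral_distr)
  qed (use \<alpha> in auto)
qed

context stationary_law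
begin

text \<open>Stationarity is assumed for nonnegative functions, where no question of integrability
  arises. Applied to the positive and the negative part it yields both claims at once.\<close>

lemma
  fixes f :: "real \<Rightarrow> real"
  assumes f [measurable]: "f \<in> borel_measurable borel"
    and int: "integrable M (\<lambda>x. f (1 + 1 / x))" "integrable M (\<lambda>x. f (1 / (1 + x)))"
  shows integrable_split: "integrable M f"
    and integral_split: "(\<integral>x. f x \<partial>M) =
      \<alpha> * (\<integral>x. f (1 + 1 / x) \<partial>M) + (1 - \<alpha>) * (\<integral>x. f (1 / (1 + x)) \<partial>M)"
proof -
  have fin: "(\<integral>\<^sup>+x. ennreal (f (1 + 1 / x)) \<partial>M) < \<infinity>" "(\<integral>\<^sup>+x. ennreal (- f (1 + 1 / x)) \<partial>M) < \<infinity>"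
    "(\<integral>\<^sup>+x. ennreal (f (1 / (1 + x))) \<partial>M) < \<infinity>" "(\<integral>\<^sup>+x. ennreal (- f (1 / (1 + x))) \<partial>M) < \<infinity>"
    using int by (auto simp: real_integrable_def less_top)
  have *: "(\<integral>\<^sup>+x. ennreal (f x) \<partial>M) = ennreal \<alpha> * (\<integral>\<^sup>+x. ennreal (f (1 + 1 / x)) \<partial>M) +
        ennreal (1 - \<alpha>) * (\<integral>\<^sup>+x. ennreal (f (1 / (1 + x))) \<partial>M)"
    "(\<integral>\<^sup>+x. ennreal (- f x) \<partial>M) = ennreal \<alpha> * (\<integral>\<^sup>+x. ennreal (- f (1 + 1 / x)) \<partial>M) +
        ennreal (1 - \<alpha>) * (\<integral>\<^sup>+x. ennreal (- f (1 / (1 + x))) \<partial>M)"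
    by (rule nn_integral_split; measurable)+
  show i: "integrable M f"
    using fin by (auto simp: real_integrable_def * less_top[symmetric] ennreal_mult_eq_top_iff)
  show "(\<integral>x. f x \<partial>M) =
      \<alpha> * (\<integral>x. f (1 + 1 / x) \<partial>M) + (1 - \<alpha>) * (\<integral>x. f (1 / (1 + x)) \<partial>M)"
    using fin \<alpha> unfolding real_lebesgue_integral_def[OF i] real_lebesgue_integral_def[OF int(1)]
      real_lebesgue_integral_def[OF int(2)] *
    by (simp add: enn2real_plus enn2real_mult ennreal_mult_less_top algebra_simps)
qed

lemma measure_split:
  assumes A [measurable]: "A \<in> sets borel"
  shows "measure M A = \<alpha> * measure M {x. 1 + 1 / x \<in> A} + (1 - \<alpha>) * measure M {x. 1 / (1 + x) \<in> A}"
proof -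
  have sp: "space M = UNIV" using sets_eq_imp_space_eq[OF sets_M] by simp
  have i: "integrable M (\<lambda>x. indicator A (g x) :: real)" if [measurable]: "g \<in> borel_measurable borel" for g
    by (rule integrable_const_bound[of _ 1]) auto
  have m: "(\<integral>x. indicator A (g x) \<partial>M) = measure M {x. g x \<in> A}"
    if [measurable]: "g \<in> borel_measurable borel" for g
  proof -
    have "(\<lambda>x. indicator A (g x) :: real) = indicator {x. g x \<in> A}" by (auto simp: indicator_def)
    then show ?thesis by (simp add: sp)
  qed
  show ?thesis
    using integral_split[of "indicator A", OF _ i i] m[of "\<lambda>x. 1 + 1 / x"] m[of "\<lambda>x. 1 / (1 + x)"]
    by (simp add: sp)
qed

end

section \<open>Stationary laws obey the Stern-Brocot mass rules\<close>

lemma SB_set_borel [measurable]: "SB_set a b c d \<in> sets borel"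
proof -
  have "SB_set a b c d = {real a / real b..} \<inter> (if d = 0 then UNIV else {..real c / real d})"
    by (auto simp: SB_set_def)
  then show ?thesis by simp
qed

text \<open>Inserting a mediant preserves the determinant \<open>b * c - a * d\<close> and counts
  one endpoint twice, which adds at least 1 to the sum of the four entries. These two facts later
  bound the length of an interval by its rank.\<close>

lemma SB_interval_invariants:
  assumes "SB_interval r a b c d"
  shows "0 < b" "0 < c" "b * c = a * d + 1" "r + 2 \<le> a + b + c + d"
  using assms by (induction rule: SB_interval.induct) (auto simp: algebra_simps)

text \<open>
  The defining induction cuts intervals; here the outermost one of the maps \<open>x \<mapsto> 1 + 1/x\<close>,
  \<open>x \<mapsto> 1/(1+x)\<close> is removed. Both reverse the orientation, which accounts for the parity in
  the definition of the measures.
\<close>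

lemma SB_interval_Suc_cases:
  assumes "SB_interval (Suc r) a b c d"
  shows "b \<le> a \<and> d \<le> c \<and> SB_interval r d (c - d) b (a - b) \<or>
         a \<le> b \<and> c \<le> d \<and> SB_interval r (d - c) c (b - a) a"
  using assms
proof (induction "Suc r" a b c d arbitrary: r rule: SB_interval.induct)
  case (left r a b c d)
  show ?case
  proof (cases r)
    case 0
    with left.hyps(1) have "a = 0 \<and> b = 1 \<and> c = 1 \<and> d = 0" by (auto elim: SB_interval.cases)
    with 0 show ?thesis using SB_interval.root by simp
  next
    case (Suc s)
    from left.hyps(2)[OF Suc] show ?thesis
    proof
      assume *: "b \<le> a \<and> d \<le> c \<and> SB_interval s d (c - d) b (a - b)"
      then have "SB_interval (Suc s) (d + b) (c - d + (a - b)) b (a - b)"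
        by (intro SB_interval.right) simp
      moreover have "c - d + (a - b) = a + c - (b + d)" using * by simp
      ultimately show ?thesis using * Suc by (simp add: add.commute)
    next
      assume *: "a \<le> b \<and> c \<le> d \<and> SB_interval s (d - c) c (b - a) a"
      then have "SB_interval (Suc s) (d - c + (b - a)) (c + a) (b - a) a"
        by (intro SB_interval.right) simp
      moreover have "d - c + (b - a) = b + d - (a + c)" using * by simp
      ultimately show ?thesis using * Suc by (simp add: add.commute)
    qed
  qed
next
  case (right r a b c d)
  show ?case
  proof (cases r)
    case 0
    with right.hyps(1) have "a = 0 \<and> b = 1 \<and> c = 1 \<and> d = 0" by (auto elim: SB_interval.cases)
    with 0 show ?thesis using SB_interval.root by simp
  next
    case (Suc s)
    from right.hyps(2)[OF Suc] show ?thesis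
    proof
      assume *: "b \<le> a \<and> d \<le> c \<and> SB_interval s d (c - d) b (a - b)"
      then have "SB_interval (Suc s) d (c - d) (d + b) (c - d + (a - b))"
        by (intro SB_interval.left) simp
      moreover have "c - d + (a - b) = a + c - (b + d)" using * by simp
      ultimately show ?thesis using * Suc by (simp add: add.commute)
    next
      assume *: "a \<le> b \<and> c \<le> d \<and> SB_interval s (d - c) c (b - a) a"
      then have "SB_interval (Suc s) (d - c) c (d - c + (b - a)) (c + a)"
        by (intro SB_interval.left) simp
      moreover have "d - c + (b - a) = b + d - (a + c)" using * by simp
      ultimately show ?thesis using * Suc by (simp add: add.commute)
    qed
  qed
qed

context stationary_law
begin

text \<open>Here \<open>1/(1+x)\<close> contributes nothing, since it stays below 1. The interval on
  the right is the preimage under the decreasing map \<open>1 + 1/x\<close>, hence the exchanged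
  endpoints; \<open>d < c\<close> keeps its left denominator positive.\<close>

lemma measure_SB_set_ge_1:
  assumes "b \<le> a" "d < c" "0 < b"
  shows "measure M (SB_set a b c d) = \<alpha> * measure M (SB_set d (c - d) b (a - b))"
proof -
  have "measure M {x. 1 + 1 / x \<in> SB_set a b c d} = measure M (SB_set d (c - d) b (a - b))"
  proof (rule measure_eq_AE)
    show "AE x in M. (x \<in> {x. 1 + 1 / x \<in> SB_set a b c d}) = (x \<in> SB_set d (c - d) b (a - b))"
      using AE_pos
    proof eventually_elim
      case (elim x)
      have "real a / real b \<le> 1 + 1 / x \<longleftrightarrow> a - b = 0 \<or> x \<le> real b / real (a - b)"
        using elim assms by (cases "a = b") (auto simp: field_simps of_nat_diff)
      moreover have "(d = 0 \<or> 1 + 1 / x \<le> real c / real d) \<longleftrightarrow> real d / real (c - d) \<le> x"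
        using elim assms by (cases "d = 0") (auto simp: field_simps of_nat_diff)
      ultimately show ?case by (auto simp: SB_set_def)
    qed
  qed measurable
  moreover have "measure M {x. 1 / (1 + x) \<in> SB_set a b c d} = measure M {}"
  proof (rule measure_eq_AE)
    show "AE x in M. (x \<in> {x. 1 / (1 + x) \<in> SB_set a b c d}) = (x \<in> {})"
      using AE_pos
    proof eventually_elim
      case (elim x)
      have "1 / (1 + x) < 1" using elim by (simp add: field_simps)
      also have "1 \<le> real a / real b" using assms by simp
      finally show ?case by (auto simp: SB_set_def)
    qed
  qed measurable
  ultimately show ?thesis using measure_split[of "SB_set a b c d"] by simp
qed

text \<open>The mirror case: \<open>1 + 1/x\<close> stays above 1, and the preimage is taken under
  \<open>1/(1+x)\<close>.\<close>

lemma measure_SB_set_le_1: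
  assumes "a \<le> b" "c \<le> d" "0 < b" "0 < c"
  shows "measure M (SB_set a b c d) = (1 - \<alpha>) * measure M (SB_set (d - c) c (b - a) a)"
proof -
  have "measure M {x. 1 / (1 + x) \<in> SB_set a b c d} = measure M (SB_set (d - c) c (b - a) a)"
  proof (rule measure_eq_AE)
    show "AE x in M. (x \<in> {x. 1 / (1 + x) \<in> SB_set a b c d}) = (x \<in> SB_set (d - c) c (b - a) a)"
      using AE_pos
    proof eventually_elim
      case (elim x)
      have "real a / real b \<le> 1 / (1 + x) \<longleftrightarrow> a = 0 \<or> x \<le> real (b - a) / real a"
        using elim assms by (cases "a = 0") (auto simp: field_simps of_nat_diff)
      moreover have "1 / (1 + x) \<le> real c / real d \<longleftrightarrow> real (d - c) / real c \<le> x" "d \<noteq> 0"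
        using elim assms by (auto simp: field_simps of_nat_diff)
      ultimately show ?case by (auto simp: SB_set_def)
    qed
  qed measurable
  moreover have "measure M {x. 1 + 1 / x \<in> SB_set a b c d} = measure M {}"
  proof (rule measure_eq_AE)
    show "AE x in M. (x \<in> {x. 1 + 1 / x \<in> SB_set a b c d}) = (x \<in> {})"
      using AE_pos
    proof eventually_elim
      case (elim x)
      have "real c / real d \<le> 1" using assms by simp
      also have "1 < 1 + 1 / x" using elim by (simp add: field_simps)
      finally show ?case using assms by (auto simp: SB_set_def)
    qed
  qed measurable
  ultimately show ?thesis using measure_split[of "SB_set a b c d"] by simp
qed

lemma measure_nonneg_reals: "measure M (SB_set 0 1 1 0) = 1"
proof -
  have "AE x in M. x \<in> SB_set 0 1 1 0" using AE_pos by eventually_elim (simp add: SB_set_def)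
  then show ?thesis by (simp add: prob_eq_1)
qed

text \<open>Removing the outermost map takes the same factor from an interval and from both its
  children. It exchanges left and right and lowers the rank by one, so the change of side and the
  change of parity compensate. At rank 0 the rule gives the prescribed masses of
  \<open>[0,1]\<close> and \<open>[1,\<infinity>]\<close>.\<close>

lemma measure_SB_children:
  assumes "SB_interval r a b c d"
  shows "measure M (SB_set a b (a + c) (b + d)) =
      (if odd r then \<alpha> else 1 - \<alpha>) * measure M (SB_set a b c d) \<and>
    measure M (SB_set (a + c) (b + d) c d) =
      (if odd r then 1 - \<alpha> else \<alpha>) * measure M (SB_set a b c d)"
  using assms
proof (induction r arbitrary: a b c d)
  case 0
  then have *: "a = 0 \<and> b = 1 \<and> c = 1 \<and> d = 0" by (auto elim: SB_interval.cases)
  show ?case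
    using measure_SB_set_ge_1[of 1 1 0 1] measure_SB_set_le_1[of 0 1 1 1]
    by (simp add: * measure_nonneg_reals)
next
  case (Suc r)
  note inv = SB_interval_invariants[OF Suc.prems]
  from SB_interval_Suc_cases[OF Suc.prems] show ?case
  proof (elim disjE conjE)
    assume *: "b \<le> a" "d \<le> c" and SB: "SB_interval r d (c - d) b (a - b)"
    from SB_interval_invariants[OF SB] have "d < c" by simp
    then show ?thesis
      using Suc.IH[OF SB] * inv measure_SB_set_ge_1[of b a d c]
        measure_SB_set_ge_1[of b a "b + d" "a + c"] measure_SB_set_ge_1[of "b + d" "a + c" d c]
      by (simp add: add.commute)
  next
    assume *: "a \<le> b" "c \<le> d" and SB: "SB_interval r (d - c) c (b - a) a"
    then show ?thesis
      using Suc.IH[OF SB] inv measure_SB_set_le_1[of a b c d]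
        measure_SB_set_le_1[of a b "a + c" "b + d"] measure_SB_set_le_1[of "a + c" "b + d" c d]
      by (simp add: add.commute)
  qed
qed

lemma is_nu: "is_nu \<alpha> M"
  using measure_SB_children measure_SB_children[OF SB_interval.root] measure_nonneg_reals
  unfolding is_nu_def
  by (simp add: prob_space_axioms sets_M measure_nonneg_reals del: One_nat_def)

end

subsection \<open>Uniqueness of the measure\<close>

text \<open>The initial masses \<open>1 - \<alpha>\<close> and \<open>\<alpha>\<close> are the even
  case of the rule applied to total mass 1, so rank 0 needs no separate treatment later.\<close>

lemma is_nu_children:
  assumes "is_nu \<alpha> M" "SB_interval r a b c d"
  shows "measure M (SB_set a b (a + c) (b + d)) =
      (if odd r then \<alpha> else 1 - \<alpha>) * measure M (SB_set a b c d)"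
    and "measure M (SB_set (a + c) (b + d) c d) =
      (if odd r then 1 - \<alpha> else \<alpha>) * measure M (SB_set a b c d)"
proof -
  have "measure M (SB_set a b (a + c) (b + d)) =
      (if odd r then \<alpha> else 1 - \<alpha>) * measure M (SB_set a b c d) \<and>
    measure M (SB_set (a + c) (b + d) c d) =
      (if odd r then 1 - \<alpha> else \<alpha>) * measure M (SB_set a b c d)"
  proof (cases r)
    case 0
    with assms(2) have "a = 0 \<and> b = 1 \<and> c = 1 \<and> d = 0" by (auto elim: SB_interval.cases)
    then show ?thesis using assms(1) 0 by (simp add: is_nu_def)
  next
    case (Suc s)
    then have "r \<ge> 1" by simp
    then show ?thesis using assms unfolding is_nu_def by blast
  qed
  then show "measure M (SB_set a b (a + c) (b + d)) =
      (if odd r then \<alpha> else 1 - \<alpha>) * measure M (SB_set a b c d)"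
    and "measure M (SB_set (a + c) (b + d) c d) =
      (if odd r then 1 - \<alpha> else \<alpha>) * measure M (SB_set a b c d)"
    by blast+
qed

lemma SB_mediant_between:
  assumes "SB_interval r a b c d"
  shows "real a / real b \<le> real (a + c) / real (b + d)"
    and "d \<noteq> 0 \<Longrightarrow> real (a + c) / real (b + d) \<le> real c / real d"
proof -
  note inv = SB_interval_invariants[OF assms]
  have *: "real b * real c = real a * real d + 1"
    using inv(3) by (metis of_nat_1 of_nat_add of_nat_mult)
  show "real a / real b \<le> real (a + c) / real (b + d)"
    using inv(1,2) * by (simp add: divide_simps algebra_simps)
  show "d \<noteq> 0 \<Longrightarrow> real (a + c) / real (b + d) \<le> real c / real d"
    using inv(1,2) * by (simp add: divide_simps algebra_simps)
qed

lemma SB_set_children: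
  assumes "SB_interval r a b c d"
  shows "SB_set a b c d = SB_set a b (a + c) (b + d) \<union> SB_set (a + c) (b + d) c d"
    and "SB_set a b (a + c) (b + d) \<inter> SB_set (a + c) (b + d) c d = {real (a + c) / real (b + d)}"
  using SB_mediant_between[OF assms] SB_interval_invariants(1)[OF assms]
  by (cases "d = 0"; fastforce simp: SB_set_def)+

text \<open>The proportions of the two children add up to 1 although the closed children overlap in
  the mediant; inclusion-exclusion leaves no mass for that point.\<close>

lemma is_nu_mediant_null:
  assumes nu: "is_nu \<alpha> M" and SB: "SB_interval r a b c d"
  shows "measure M {real (a + c) / real (b + d)} = 0"
proof -
  interpret prob_space M using nu by (simp add: is_nu_def)
  have [measurable_cong]: "sets M = sets borel" using nu by (simp add: is_nu_def)
  have "measure M (SB_set a b c d) + measure M {real (a + c) / real (b + d)} =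
      measure M (SB_set a b (a + c) (b + d)) + measure M (SB_set (a + c) (b + d) c d)"
    unfolding SB_set_children(1)[OF SB]
    using measure_Un3[of "SB_set a b (a + c) (b + d)" M "SB_set (a + c) (b + d) c d"]
      SB_set_children(2)[OF SB]
    by (simp add: fmeasurable_eq_sets)
  then show ?thesis using is_nu_children[OF nu SB] by (cases "odd r") (simp_all add: algebra_simps)
qed

text \<open>The tail from the left endpoint is carried through the induction. A left child keeps
  that endpoint; for a right child the tail loses exactly the mass of the left sibling, because the
  mediant is null.\<close>

lemma is_nu_SB_unique:
  assumes M: "is_nu \<alpha> M" and N: "is_nu \<alpha> N" and SB: "SB_interval r a b c d"
  shows "measure M (SB_set a b c d) = measure N (SB_set a b c d) \<and>
    measure M {real a / real b..} = measure N {real a / real b..}"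
  using SB
proof (induction rule: SB_interval.induct)
  case root
  have "SB_set 0 1 1 0 = {0..}" by (auto simp: SB_set_def)
  with M N show ?case by (simp add: is_nu_def)
next
  case (left r a b c d)
  then show ?case using is_nu_children[OF M left.hyps] is_nu_children[OF N left.hyps] by simp
next
  case (right r a b c d)
  let ?m = "real (a + c) / real (b + d)"
  have tail: "measure K {real a / real b..} = measure K (SB_set a b (a + c) (b + d)) + measure K {?m..}"
    if K: "is_nu \<alpha> K" for K
  proof -
    interpret prob_space K using K by (simp add: is_nu_def)
    have [measurable_cong]: "sets K = sets borel" using K by (simp add: is_nu_def)
    have "SB_set a b (a + c) (b + d) \<union> {?m..} = {real a / real b..}"
      "SB_set a b (a + c) (b + d) \<inter> {?m..} = {?m}"
      using SB_mediant_between(1)[OF right.hyps] SB_interval_invariants(1)[OF right.hyps]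
      by (auto simp: SB_set_def)
    then show ?thesis
      using measure_Un3[of "SB_set a b (a + c) (b + d)" K "{?m..}"]
        is_nu_mediant_null[OF K right.hyps]
      by (simp add: fmeasurable_eq_sets)
  qed
  have "measure M (SB_set a b (a + c) (b + d)) = measure N (SB_set a b (a + c) (b + d))"
    "measure M (SB_set (a + c) (b + d) c d) = measure N (SB_set (a + c) (b + d) c d)"
    using right.IH by (simp_all only: is_nu_children[OF M right.hyps] is_nu_children[OF N right.hyps])
  with right.IH tail[OF M] tail[OF N] show ?case by linarith
qed

lemma ex_SB_set:
  assumes "0 \<le> x"
  shows "\<exists>a b c d. SB_interval r a b c d \<and> x \<in> SB_set a b c d"
proof (induction r)
  case 0
  have "x \<in> SB_set 0 1 1 0" using assms by (simp add: SB_set_def)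
  then show ?case using SB_interval.root by blast
next
  case (Suc r)
  then obtain a b c d where SB: "SB_interval r a b c d" and x: "x \<in> SB_set a b c d" by blast
  from x have "x \<in> SB_set a b (a + c) (b + d) \<or> x \<in> SB_set (a + c) (b + d) c d"
    using SB_set_children(1)[OF SB] by blast
  then show ?case using SB_interval.left[OF SB] SB_interval.right[OF SB] by blast
qed

text \<open>In the coordinate \<open>x/(1+x)\<close> the interval \<open>[a/b, c/d]\<close> becomes a Farey interval, of length
  \<open>1/((a+b)(c+d))\<close>.\<close>

lemma SB_set_length:
  assumes SB: "SB_interval r a b c d" and x: "x \<in> SB_set a b c d"
  shows "x / (1 + x) - (real a / real b) / (1 + real a / real b) \<le> 1 / real (Suc r)"
proof -
  note inv = SB_interval_invariants[OF SB]
  have *: "real b * real c = real a * real d + 1"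
    using inv(3) by (metis of_nat_1 of_nat_add of_nat_mult)
  have x0: "x \<ge> 0" using x by (auto simp: SB_set_def intro: order_trans[rotated])
  have "x / (1 + x) \<le> real c / real (c + d)"
  proof (cases "d = 0")
    case True
    then show ?thesis using x0 inv(2) by (simp add: field_simps)
  next
    case False
    then have "x * real d \<le> real c" using x by (auto simp: SB_set_def field_simps)
    then show ?thesis using x0 False by (simp add: field_simps)
  qed
  moreover have "(real a / real b) / (1 + real a / real b) = real a / real (a + b)"
    using inv(1) by (simp add: field_simps)
  moreover have "real c / real (c + d) - real a / real (a + b) = 1 / (real (a + b) * real (c + d))"
    using inv(1,2) * by (simp add: field_simps)
  moreover have "1 / (real (a + b) * real (c + d)) \<le> 1 / real (Suc r)"
  proof -
    \<comment> \<open>Among positive integers of given sum the product is smallest when one factor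
      is 1.\<close>
    have "Suc u \<le> p * q" if "1 \<le> p" "1 \<le> q" "u + 2 \<le> p + q" for p q u :: nat
    proof -
      obtain p' q' where "p = Suc p'" "q = Suc q'" using \<open>1 \<le> p\<close> \<open>1 \<le> q\<close>
        by (metis One_nat_def Suc_le_D)
      then show ?thesis using that(3) by simp
    qed
    then have "Suc r \<le> (a + b) * (c + d)" using inv by simp
    then have "real (Suc r) \<le> real ((a + b) * (c + d))" by (rule of_nat_mono)
    then show ?thesis by (intro divide_left_mono) (auto simp del: of_nat_Suc)
  qed
  ultimately show ?thesis by linarith
qed

text \<open>At a rank where intervals are shorter than the gap between \<open>x\<close> and
  \<open>y\<close> in the coordinate \<open>x/(1+x)\<close>, the left endpoint of an interval
  containing \<open>y\<close> falls between them.\<close>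

lemma SB_left_endpoint_dense:
  assumes "0 \<le> x" "x < y"
  shows "\<exists>r a b c d. SB_interval r a b c d \<and> x < real a / real b \<and> real a / real b \<le> y"
proof -
  have "x / (1 + x) < y / (1 + y)"
    using assms by (simp add: pos_divide_less_eq pos_less_divide_eq algebra_simps)
  then have "0 < y / (1 + y) - x / (1 + x)" by simp
  then obtain r where r: "1 / real (Suc r) < y / (1 + y) - x / (1 + x)"
    using nat_approx_posE by blast
  from ex_SB_set[of y r] assms obtain a b c d where
    SB: "SB_interval r a b c d" and y: "y \<in> SB_set a b c d" by auto
  define q where "q = real a / real b"
  have "q \<ge> 0" by (simp add: q_def)
  have "x / (1 + x) < q / (1 + q)"
    using SB_set_length[OF SB y] r unfolding q_def by linarith
  then have "x < q" using \<open>q \<ge> 0\<close> assms by (simp add: field_simps)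
  moreover have "q \<le> y" using y by (simp add: SB_set_def q_def)
  ultimately show ?thesis using SB unfolding q_def by blast
qed

text \<open>An inequality suffices, as the roles of \<open>M\<close> and \<open>N\<close> can be
  exchanged. For \<open>x < y\<close> a left endpoint in between separates the two tails, and there
  the measures agree; then \<open>y\<close> decreases to \<open>x\<close>. Negative \<open>x\<close>
  lies below all endpoints and is settled by total mass.\<close>

lemma is_nu_tail_le:
  assumes M: "is_nu \<alpha> M" and N: "is_nu \<alpha> N"
  shows "measure M {x<..} \<le> measure N {x<..}"
proof -
  interpret M: prob_space M using M by (simp add: is_nu_def)
  interpret N: prob_space N using N by (simp add: is_nu_def)
  have sets [measurable_cong]: "sets M = sets borel" "sets N = sets borel"
    using M N by (auto simp: is_nu_def)
  show ?thesis
  proof (cases "x < 0")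
    case True
    have "SB_set 0 1 1 0 \<subseteq> {x<..}" using True by (auto simp: SB_set_def)
    then have "measure N (SB_set 0 1 1 0) \<le> measure N {x<..}"
      by (intro N.finite_measure_mono) auto
    with N have "1 \<le> measure N {x<..}" by (simp add: is_nu_def)
    with M.prob_le_1 show ?thesis by (rule order_trans)
  next
    case False
    have le: "measure M {y..} \<le> measure N {x<..}" if "x < y" for y
    proof -
      from SB_left_endpoint_dense[of x y] False that obtain r a b c d where
        SB: "SB_interval r a b c d" and q: "x < real a / real b" "real a / real b \<le> y" by auto
      have "measure M {y..} \<le> measure M {real a / real b..}"
        using q by (intro M.finite_measure_mono) auto
      also have "\<dots> = measure N {real a / real b..}" using is_nu_SB_unique[OF M N SB] by simp
      also have "\<dots> \<le> measure N {x<..}"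
        using q by (intro N.finite_measure_mono) auto
      finally show ?thesis .
    qed
    have "(\<Union>n. {x + 1 / real (Suc n)..}) = {x<..}"
    proof (intro equalityI subsetI)
      fix y assume "y \<in> {x<..}"
      then obtain n where "1 / real (Suc n) < y - x" using nat_approx_posE[of "y - x"] by auto
      then show "y \<in> (\<Union>n. {x + 1 / real (Suc n)..})" by (intro UN_I[of n]) auto
    qed (auto intro: less_le_trans[rotated])
    moreover have "incseq (\<lambda>n. {x + 1 / real (Suc n)..})"
      by (intro monoI) (auto simp: field_simps intro: order_trans[rotated])
    moreover have "range (\<lambda>n. {x + 1 / real (Suc n)..}) \<subseteq> sets M" by (auto simp: sets)
    ultimately have "(\<lambda>n. measure M {x + 1 / real (Suc n)..}) \<longlonglongrightarrow> measure M {x<..}"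
      using M.finite_Lim_measure_incseq[of "\<lambda>n. {x + 1 / real (Suc n)..}"]
      by (simp del: of_nat_Suc)
    then show ?thesis by (rule LIMSEQ_le_const2) (auto intro!: le)
  qed
qed

lemma is_nu_unique:
  assumes M: "is_nu \<alpha> M" and N: "is_nu \<alpha> N"
  shows "M = N"
proof (rule measure_eqI_lessThan)
  interpret M: prob_space M using M by (simp add: is_nu_def)
  interpret N: prob_space N using N by (simp add: is_nu_def)
  show "emeasure M {x<..} < \<infinity>" for x by (simp add: M.emeasure_eq_measure)
  show "emeasure M {x<..} = emeasure N {x<..}" for x
    using is_nu_tail_le[OF M N, of x] is_nu_tail_le[OF N M, of x]
    by (simp add: M.emeasure_eq_measure N.emeasure_eq_measure)
qed (use M N in \<open>auto simp: is_nu_def\<close>)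

text \<open>Existence and uniqueness identify the definite description behind \<open>nu\<close> with
  the constructed law. From here on only stationarity is used.\<close>

lemma stationary_law_nu:
  assumes "0 \<le> \<alpha>" "\<alpha> \<le> 1"
  shows "stationary_law (nu \<alpha>) \<alpha>"
proof -
  let ?M = "distr (coins \<alpha>) borel (\<lambda>\<omega>. limit_point \<omega> / (1 - limit_point \<omega>))"
  interpret stationary_law ?M \<alpha> by (rule stationary_law_exists[OF assms])
  have "nu \<alpha> = ?M"
    unfolding nu_def by (rule the_equality) (rule is_nu, rule is_nu_unique[OF _ is_nu])
  then show ?thesis using stationary_law_axioms by simp
qed

subsection \<open>Logarithmic moments\<close>

lemma ln_1p_inverse_le:
  fixes x :: real
  assumes "0 < x"
  shows "ln (1 + 1 / x) \<le> ln 2 + max 0 (- ln x)"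
proof (cases "x \<le> 1")
  case True
  have "ln (1 + 1 / x) \<le> ln (2 / x)" using assms True by (simp add: field_simps)
  also have "\<dots> = ln 2 - ln x" using assms by (simp add: ln_div)
  finally show ?thesis by simp
next
  case False
  have "ln (1 + 1 / x) \<le> ln 2" using False by (simp add: field_simps)
  then show ?thesis by (simp add: max_def)
qed

lemma ln_1p_le:
  fixes x :: real
  assumes "0 < x"
  shows "ln (1 + x) \<le> ln 2 + max 0 (ln x)"
  using ln_1p_inverse_le[of "1 / x"] assms by (simp add: ln_div)

context stationary_law
begin

text \<open>
  The maps \<open>1 + 1/x\<close> and \<open>1/(1+x)\<close> send the negative part of the logarithm to its positive part
  and vice versa, up to a constant. Truncation is needed to know beforehand that the integrals
  are finite.
\<close>

lemma truncated_ln_bounds: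
  fixes n :: nat
  defines "P \<equiv> (\<integral>x. min n (max 0 (ln x)) \<partial>M)" and "Q \<equiv> (\<integral>x. min n (max 0 (- ln x)) \<partial>M)"
  shows "P \<le> \<alpha> * (ln 2 + Q)" "Q \<le> (1 - \<alpha>) * (ln 2 + P)"
proof -
  have i: "integrable M (\<lambda>x. min (real n) (max 0 (f x)))"
    if [measurable]: "f \<in> borel_measurable borel" for f :: "real \<Rightarrow> real"
    by (rule integrable_const_bound[of _ "real n"]) auto
  have P: "P = \<alpha> * (\<integral>x. min n (max 0 (ln (1 + 1 / x))) \<partial>M) +
      (1 - \<alpha>) * (\<integral>x. min n (max 0 (ln (1 / (1 + x)))) \<partial>M)"
    unfolding P_def by (intro integral_split i) measurable
  have Q: "Q = \<alpha> * (\<integral>x. min n (max 0 (- ln (1 + 1 / x))) \<partial>M) +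
      (1 - \<alpha>) * (\<integral>x. min n (max 0 (- ln (1 / (1 + x)))) \<partial>M)"
    unfolding Q_def by (intro integral_split i) measurable
  have "(\<integral>x. min n (max 0 (ln (1 / (1 + x)))) \<partial>M) = (\<integral>x. 0 \<partial>M)"
    using AE_pos by (intro integral_cong_AE, measurable, eventually_elim) (auto simp: ln_div max_absorb1)
  moreover have "(\<integral>x. min n (max 0 (ln (1 + 1 / x))) \<partial>M) \<le>
      (\<integral>x. ln 2 + min n (max 0 (- ln x)) \<partial>M)"
    using AE_pos
  proof (intro integral_mono_AE i Bochner_Integration.integrable_add, goal_cases)
    case 4
    then show ?case
    proof eventually_elim
      case (elim x)
      have "0 \<le> ln (1 + 1 / x)" using elim by simp
      moreover have "0 \<le> ln (2::real)" by simp
      \<comment> \<open>Capping at \<open>n\<close> keeps the pointwise bound because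
        \<open>ln 2\<close> is nonnegative.\<close>
      ultimately show ?case using ln_1p_inverse_le[OF elim] by linarith
    qed
  qed auto
  moreover have "(\<integral>x. ln 2 + min n (max 0 (- ln x)) \<partial>M) = ln 2 + Q"
    unfolding Q_def by (subst Bochner_Integration.integral_add) (auto intro!: i simp: prob_space)
  ultimately show "P \<le> \<alpha> * (ln 2 + Q)"
    using \<alpha> unfolding P by (auto intro!: mult_left_mono)
  have "(\<integral>x. min n (max 0 (- ln (1 + 1 / x))) \<partial>M) = (\<integral>x. 0 \<partial>M)"
    using AE_pos by (intro integral_cong_AE, measurable, eventually_elim) (auto simp: max_absorb1)
  moreover have "(\<integral>x. min n (max 0 (- ln (1 / (1 + x)))) \<partial>M) \<le>
      (\<integral>x. ln 2 + min n (max 0 (ln x)) \<partial>M)"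
    using AE_pos
  proof (intro integral_mono_AE i Bochner_Integration.integrable_add, goal_cases)
    case 4
    then show ?case
    proof eventually_elim
      case (elim x)
      have "0 \<le> ln (1 + x)" using elim by simp
      moreover have "0 \<le> ln (2::real)" by simp
      moreover have "- ln (1 / (1 + x)) = ln (1 + x)" using elim by (simp add: ln_div)
      ultimately show ?case using ln_1p_le[OF elim] by linarith
    qed
  qed auto
  moreover have "(\<integral>x. ln 2 + min n (max 0 (ln x)) \<partial>M) = ln 2 + P"
    unfolding P_def by (subst Bochner_Integration.integral_add) (auto intro!: i simp: prob_space)
  ultimately show "Q \<le> (1 - \<alpha>) * (ln 2 + P)"
    using \<alpha> unfolding Q by (auto intro!: mult_left_mono)
qed

text \<open>Substituting one truncated bound into the other gives \<open>P\<close> at most a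
  constant plus \<open>\<alpha> * (1 - \<alpha>) * P\<close>, with coefficient at most 1/4. So
  \<open>P \<le> 2\<close> and \<open>Q \<le> 3\<close> for every truncation level, and monotone
  convergence removes the truncation.\<close>

lemma integrable_ln: "integrable M ln"
proof -
  have int: "integrable M (\<lambda>x. min (real n) (f x))"
    if [measurable]: "f \<in> borel_measurable borel" and "\<And>x. f x \<ge> 0" for f :: "real \<Rightarrow> real" and n
    using that(2) by (intro integrable_const_bound[of _ "real n"]) (auto simp: that(2))
  have bound: "(\<integral>x. min (real n) \<bar>ln x\<bar> \<partial>M) \<le> 5" for n
  proof -
    define P where "P = (\<integral>x. min n (max 0 (ln x)) \<partial>M)"
    define Q where "Q = (\<integral>x. min n (max 0 (- ln x)) \<partial>M)"
    have "(\<integral>x. min (real n) \<bar>ln x\<bar> \<partial>M) = (\<integral>x. min n (max 0 (ln x)) + min n (max 0 (- ln x)) \<partial>M)"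
      by (intro Bochner_Integration.integral_cong) (auto simp: max_def abs_if)
    also have "\<dots> = P + Q"
      unfolding P_def Q_def by (intro Bochner_Integration.integral_add int) auto
    finally have PQ: "(\<integral>x. min (real n) \<bar>ln x\<bar> \<partial>M) = P + Q" .
    have P: "P \<le> \<alpha> * (ln 2 + Q)" and Q: "Q \<le> (1 - \<alpha>) * (ln 2 + P)"
      using truncated_ln_bounds[of n] unfolding P_def Q_def by auto
    have "P \<ge> 0" unfolding P_def by (rule integral_nonneg_AE) auto
    have l2: "0 \<le> ln (2::real)" "ln (2::real) \<le> 1" using ln_add_one_self_le_self[of 1] by auto
    have a: "\<alpha> * (1 - \<alpha>) \<le> 1 / 4"
      using zero_le_power2[of "\<alpha> - 1 / 2"] by (simp add: power2_eq_square algebra_simps)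
    have "\<alpha> * (ln 2 + Q) \<le> \<alpha> * (ln 2 + (1 - \<alpha>) * (ln 2 + P))"
      using Q \<alpha> by (intro mult_left_mono) auto
    also have "\<dots> = \<alpha> * ln 2 + (\<alpha> * (1 - \<alpha>)) * (ln 2 + P)" by (simp add: algebra_simps)
    also have "\<dots> \<le> 1 * 1 + 1 / 4 * (1 + P)"
      using \<alpha> a l2 \<open>P \<ge> 0\<close> by (intro add_mono mult_mono) auto
    finally have "P \<le> 1 * 1 + 1 / 4 * (1 + P)" by (rule order_trans[OF P])
    then have "P \<le> 2" by argo
    have "(1 - \<alpha>) * (ln 2 + P) \<le> 1 * (1 + 2)"
      using \<alpha> l2 \<open>P \<ge> 0\<close> \<open>P \<le> 2\<close> by (intro mult_mono) auto
    then have "Q \<le> 1 * (1 + 2)" by (rule order_trans[OF Q])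
    with \<open>P \<le> 2\<close> show ?thesis unfolding PQ by simp
  qed
  have mono: "incseq (\<lambda>n. \<integral>x. min (real n) \<bar>ln x\<bar> \<partial>M)"
    by (intro monoI integral_mono int) auto
  then obtain L where L: "(\<lambda>n. \<integral>x. min (real n) \<bar>ln x\<bar> \<partial>M) \<longlonglongrightarrow> L"
    using incseq_convergent[of _ 5] bound by metis
  have "integrable M (\<lambda>x. \<bar>ln x\<bar>)"
  proof (rule integrable_monotone_convergence)
    show "integrable M (\<lambda>x. min (real n) \<bar>ln x\<bar>)" for n by (intro int) auto
    show "AE x in M. mono (\<lambda>n. min (real n) \<bar>ln x\<bar>)" by (auto intro!: monoI)
    show "AE x in M. (\<lambda>n. min (real n) \<bar>ln x\<bar>) \<longlonglongrightarrow> \<bar>ln x\<bar>"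
    proof (rule AE_I2)
      fix x
      obtain N :: nat where N: "\<bar>ln x\<bar> \<le> real N" using real_arch_simple by blast
      have "\<forall>\<^sub>F n in sequentially. min (real n) \<bar>ln x\<bar> = \<bar>ln x\<bar>"
        using eventually_ge_at_top[of N]
        by eventually_elim (use N in \<open>auto simp: min_def\<close>)
      then show "(\<lambda>n. min (real n) \<bar>ln x\<bar>) \<longlonglongrightarrow> \<bar>ln x\<bar>" by (rule tendsto_eventually)
    qed
  qed (use L in auto)
  then show ?thesis by (subst (asm) integrable_abs_iff) auto
qed

lemma integrable_ln_1p: "integrable M (\<lambda>x. ln (1 + x))"
proof (rule Bochner_Integration.integrable_bound)
  show "integrable M (\<lambda>x. ln 2 + \<bar>ln x\<bar>)" using integrable_ln by simp
  show "AE x in M. norm (ln (1 + x)) \<le> norm (ln 2 + \<bar>ln x\<bar>)"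
    using AE_pos by eventually_elim (use ln_1p_le in force)
qed measurable

text \<open>Invariance is applied to \<open>ln\<close>, whose values along the two maps are
  \<open>ln (1 + x) - ln x\<close> and \<open>- ln (1 + x)\<close>.\<close>

lemma ln_balance: "(1 + \<alpha>) * (\<integral>x. ln x \<partial>M) = (2 * \<alpha> - 1) * (\<integral>x. ln (1 + x) \<partial>M)"
proof -
  have R: "AE x in M. ln (1 + x) - ln x = ln (1 + 1 / x)"
    using AE_pos
  proof eventually_elim
    case (elim x)
    then have "1 + 1 / x = (1 + x) / x" by (simp add: field_simps)
    with elim show ?case by (simp add: ln_div)
  qed
  have Q: "AE x in M. - ln (1 + x) = ln (1 / (1 + x))"
    using AE_pos by eventually_elim (simp add: ln_div)
  have iR: "integrable M (\<lambda>x. ln (1 + 1 / x))"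
    using Bochner_Integration.integrable_diff[OF integrable_ln_1p integrable_ln]
    by (rule integrable_cong_AE_imp[OF _ _ R]) measurable
  have iQ: "integrable M (\<lambda>x. ln (1 / (1 + x)))"
    using Bochner_Integration.integrable_minus[OF integrable_ln_1p] by (rule integrable_cong_AE_imp[OF _ _ Q]) measurable
  have "(\<integral>x. ln (1 + 1 / x) \<partial>M) = (\<integral>x. ln (1 + x) - ln x \<partial>M)"
    using R by (intro integral_cong_AE) auto
  then have R': "(\<integral>x. ln (1 + 1 / x) \<partial>M) = (\<integral>x. ln (1 + x) \<partial>M) - (\<integral>x. ln x \<partial>M)"
    using integrable_ln integrable_ln_1p by simp
  have Q': "(\<integral>x. ln (1 / (1 + x)) \<partial>M) = - (\<integral>x. ln (1 + x) \<partial>M)"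
    unfolding integral_minus[symmetric] using Q by (intro integral_cong_AE) auto
  have "(\<integral>x. ln x \<partial>M) = \<alpha> * ((\<integral>x. ln (1 + x) \<partial>M) - (\<integral>x. ln x \<partial>M)) +
      (1 - \<alpha>) * - (\<integral>x. ln (1 + x) \<partial>M)"
    unfolding R'[symmetric] Q'[symmetric] by (rule integral_split[OF _ iR iQ]) simp
  then show ?thesis by algebra
qed

end

section \<open>Dependence of the stationary law on its parameter\<close>

lemma (in prob_space) abs_expectation_minus_le:
  fixes f :: "'a \<Rightarrow> real"
  assumes "integrable M f" "AE x in M. \<bar>f x - c\<bar> \<le> e"
  shows "\<bar>(\<integral>x. f x \<partial>M) - c\<bar> \<le> e"
proof -
  have "(\<integral>x. f x \<partial>M) - c = (\<integral>x. f x - c \<partial>M)" using assms(1) by (simp add: prob_space)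
  also have "\<bar>\<dots>\<bar> \<le> (\<integral>x. \<bar>f x - c\<bar> \<partial>M)" by (rule integral_abs_bound)
  also have "\<dots> \<le> (\<integral>x. e \<partial>M)" using assms by (intro integral_mono_AE) auto
  finally show ?thesis by (simp add: prob_space)
qed

text \<open>
  One application of the transfer operator shrinks the scale on which the oscillation of \<open>h\<close> has to
  be controlled from \<open>1/n\<close> to \<open>1/(n+1)\<close>, at the price of an error proportional to
  \<open>\<bar>\<beta> - \<alpha>\<bar>\<close>.
\<close>

lemma stationary_law_integral_diff:
  assumes M: "stationary_law M \<beta>" and N: "stationary_law N \<alpha>"
    and "h \<in> borel_measurable borel" and "\<And>x. 0 < x \<Longrightarrow> \<bar>h x\<bar> \<le> C"
    and "\<And>x y. 0 < x \<Longrightarrow> 0 < y \<Longrightarrow> \<bar>x / (1 + x) - y / (1 + y)\<bar> \<le> 1 / real (Suc n) \<Longrightarrow>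
      \<bar>h x - h y\<bar> \<le> e"
  shows "\<bar>(\<integral>x. h x \<partial>M) - (\<integral>x. h x \<partial>N)\<bar> \<le> e + real n * (2 * C * \<bar>\<beta> - \<alpha>\<bar>)"
  using assms(3-)
proof (induction n arbitrary: h)
  interpret M: stationary_law M \<beta> by fact
  interpret N: stationary_law N \<alpha> by fact
  {
    case 0
    note [measurable] = \<open>h \<in> borel_measurable borel\<close>
    \<comment> \<open>Scale 1 is no restriction in the coordinate \<open>x/(1+x)\<close>, so
      \<open>e\<close> bounds the total oscillation of \<open>h\<close>.\<close>
    have osc: "\<bar>h x - h y\<bar> \<le> e" if "0 < x" "0 < y" for x y
    proof (rule "0.prems"(3)[OF that])
      have "0 \<le> x / (1 + x)" "x / (1 + x) \<le> 1" "0 \<le> y / (1 + y)" "y / (1 + y) \<le> 1"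
        using that by auto
      then show "\<bar>x / (1 + x) - y / (1 + y)\<bar> \<le> 1 / real (Suc 0)" by (simp add: abs_le_iff)
    qed
    have iM: "integrable M h"
      by (rule M.integrable_const_bound[of _ C]) (use M.AE_pos "0.prems"(2) in \<open>auto elim: eventually_mono\<close>)
    have iN: "integrable N h"
      by (rule N.integrable_const_bound[of _ C]) (use N.AE_pos "0.prems"(2) in \<open>auto elim: eventually_mono\<close>)
    have "\<bar>(\<integral>y. h y \<partial>N) - h x\<bar> \<le> e" if "0 < x" for x
      using iN N.AE_pos osc[OF _ that] by (intro N.abs_expectation_minus_le) (auto elim: eventually_mono)
    then have "\<bar>(\<integral>x. h x \<partial>M) - (\<integral>x. h x \<partial>N)\<bar> \<le> e"
      using iM M.AE_pos
      by (intro M.abs_expectation_minus_le) (auto elim!: eventually_mono simp: abs_minus_commute)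
    then show ?case by simp
  next
    case (Suc n)
    note [measurable] = Suc.prems(1)
    \<comment> \<open>The operator carries the parameter of \<open>N\<close>: it leaves the integral
      against \<open>N\<close> unchanged and alters the one against \<open>M\<close> only by a
      multiple of \<open>\<beta> - \<alpha>\<close>.\<close>
    define T where "T x = \<alpha> * h (1 + 1 / x) + (1 - \<alpha>) * h (1 / (1 + x))" for x
    have hR: "\<bar>h (1 + 1 / x)\<bar> \<le> C" and hQ: "\<bar>h (1 / (1 + x))\<bar> \<le> C" if "0 < x" for x
      using that by (auto intro!: Suc.prems(2) add_pos_pos)
    have convex: "\<bar>\<alpha> * u + (1 - \<alpha>) * v\<bar> \<le> w" if "\<bar>u\<bar> \<le> w" "\<bar>v\<bar> \<le> w" for u v w :: real
    proof -
      have "\<bar>\<alpha> * u + (1 - \<alpha>) * v\<bar> \<le> \<alpha> * \<bar>u\<bar> + (1 - \<alpha>) * \<bar>v\<bar>"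
        using N.\<alpha> by (intro order_trans[OF abs_triangle_ineq]) (simp add: abs_mult)
      also have "\<dots> \<le> \<alpha> * w + (1 - \<alpha>) * w"
        using N.\<alpha> that by (intro add_mono mult_left_mono) auto
      finally show ?thesis by (simp add: algebra_simps)
    qed
    have IH: "\<bar>(\<integral>x. T x \<partial>M) - (\<integral>x. T x \<partial>N)\<bar> \<le> e + real n * (2 * C * \<bar>\<beta> - \<alpha>\<bar>)"
    proof (rule Suc.IH)
      show "T \<in> borel_measurable borel" unfolding T_def by measurable
      show "\<bar>T x\<bar> \<le> C" if "0 < x" for x
        unfolding T_def using hR[OF that] hQ[OF that] by (rule convex)
      fix x y :: real
      assume xy: "0 < x" "0 < y" "\<bar>x / (1 + x) - y / (1 + y)\<bar> \<le> 1 / real (Suc n)"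
      \<comment> \<open>In the coordinate \<open>x/(1+x)\<close> the maps become
        \<open>step\<close>, so \<open>step_contract\<close> brings the images within the finer
        scale at which \<open>h\<close> is controlled.\<close>
      have st: "(1 + 1 / z) / (1 + (1 + 1 / z)) = step True (z / (1 + z))"
        "(1 / (1 + z)) / (1 + 1 / (1 + z)) = step False (z / (1 + z))" if "0 < z" for z :: real
        using that by (auto simp: step_def divide_simps)
      have mem: "x / (1 + x) \<in> {0..1}" "y / (1 + y) \<in> {0..1}" using xy by auto
      have "\<bar>h (1 + 1 / x) - h (1 + 1 / y)\<bar> \<le> e"
        using step_contract[OF mem xy(3), of True] xy
        by (intro Suc.prems(3)) (auto simp: st[symmetric] add_pos_pos)
      moreover have "\<bar>h (1 / (1 + x)) - h (1 / (1 + y))\<bar> \<le> e"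
        using step_contract[OF mem xy(3), of False] xy
        by (intro Suc.prems(3)) (auto simp: st[symmetric] add_pos_pos)
      ultimately have "\<bar>\<alpha> * (h (1 + 1 / x) - h (1 + 1 / y)) + (1 - \<alpha>) * (h (1 / (1 + x)) - h (1 / (1 + y)))\<bar> \<le> e"
        by (rule convex)
      then show "\<bar>T x - T y\<bar> \<le> e" unfolding T_def by (simp add: algebra_simps)
    qed
    have iM: "integrable M (\<lambda>x. h (1 + 1 / x))" "integrable M (\<lambda>x. h (1 / (1 + x)))"
      by (rule M.integrable_const_bound[of _ C];
          use M.AE_pos hR hQ in \<open>auto elim: eventually_mono\<close>)+
    have iN: "integrable N (\<lambda>x. h (1 + 1 / x))" "integrable N (\<lambda>x. h (1 / (1 + x)))"
      by (rule N.integrable_const_bound[of _ C];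
          use N.AE_pos hR hQ in \<open>auto elim: eventually_mono\<close>)+
    have TN: "(\<integral>x. T x \<partial>N) = (\<integral>x. h x \<partial>N)"
      unfolding T_def N.integral_split[OF Suc.prems(1) iN] using iN by simp
    have TM: "(\<integral>x. h x \<partial>M) - (\<integral>x. T x \<partial>M) =
        (\<beta> - \<alpha>) * ((\<integral>x. h (1 + 1 / x) \<partial>M) - (\<integral>x. h (1 / (1 + x)) \<partial>M))"
      unfolding T_def M.integral_split[OF Suc.prems(1) iM] using iM by (simp add: algebra_simps)
    have "\<bar>(\<integral>x. h (1 + 1 / x) \<partial>M) - 0\<bar> \<le> C" "\<bar>(\<integral>x. h (1 / (1 + x)) \<partial>M) - 0\<bar> \<le> C"
      using iM M.AE_pos hR hQ by (intro M.abs_expectation_minus_le; auto elim: eventually_mono)+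
    then have "\<bar>(\<integral>x. h (1 + 1 / x) \<partial>M) - (\<integral>x. h (1 / (1 + x)) \<partial>M)\<bar> \<le> 2 * C" by linarith
    then have "\<bar>(\<integral>x. h x \<partial>M) - (\<integral>x. T x \<partial>M)\<bar> \<le> 2 * C * \<bar>\<beta> - \<alpha>\<bar>"
      unfolding TM abs_mult by (subst mult.commute) (rule mult_right_mono, auto)
    with IH show ?case unfolding TN by (simp add: algebra_simps)
  }
qed

subsection \<open>Double integrals\<close>

text \<open>The first two arguments lie between 1 and \<open>(1 + x) * (1 + y)\<close>. The third
  can be small but is at least \<open>x\<close>, which costs the term
  \<open>\<bar>ln x\<bar>\<close>.\<close>

lemma ln_kernel_bounds:
  fixes x y :: real
  assumes "0 < x" "0 < y"
  shows "\<bar>ln (1 + x * y)\<bar> \<le> ln (1 + x) + ln (1 + y)"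
    and "\<bar>ln (x + y + 1)\<bar> \<le> ln (1 + x) + ln (1 + y)"
    and "\<bar>ln (x + y + x * y)\<bar> \<le> \<bar>ln x\<bar> + ln (1 + x) + ln (1 + y)"
proof -
  have xy: "0 < x * y" "0 < x + y + x * y" "0 < (1 + x) * (1 + y)" using assms by (simp_all add: add_pos_pos)
  have s: "ln (1 + x) + ln (1 + y) = ln ((1 + x) * (1 + y))" using assms by (simp add: ln_mult)
  have le: "1 + x * y \<le> (1 + x) * (1 + y)" "x + y + 1 \<le> (1 + x) * (1 + y)"
    "x + y + x * y \<le> (1 + x) * (1 + y)"
    using assms xy by (auto simp: algebra_simps)
  have "0 \<le> ln (1 + x * y)" "0 \<le> ln (x + y + 1)" using assms xy by auto
  moreover have "ln x \<le> ln (x + y + x * y)" using assms xy by (subst ln_le_cancel_iff) auto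
  moreover have "ln (1 + x * y) \<le> ln ((1 + x) * (1 + y))" "ln (x + y + 1) \<le> ln ((1 + x) * (1 + y))"
    "ln (x + y + x * y) \<le> ln ((1 + x) * (1 + y))"
    using le assms xy by (subst ln_le_cancel_iff; simp add: add_pos_pos)+
  moreover have "0 \<le> ln (1 + x)" "0 \<le> ln (1 + y)" using assms by auto
  ultimately show "\<bar>ln (1 + x * y)\<bar> \<le> ln (1 + x) + ln (1 + y)"
    "\<bar>ln (x + y + 1)\<bar> \<le> ln (1 + x) + ln (1 + y)"
    "\<bar>ln (x + y + x * y)\<bar> \<le> \<bar>ln x\<bar> + ln (1 + x) + ln (1 + y)"
    using s by linarith+
qed

locale stationary_pair = M: stationary_law M \<beta> + N: stationary_law N \<alpha>
  for M :: "real measure" and \<beta> :: real and N :: "real measure" and \<alpha> :: real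
begin

sublocale pair_prob_space M N ..

text \<open>The bound is a sum of functions of one variable, each integrable because the marginals
  of the product are \<open>M\<close> and \<open>N\<close>. The second marginal is obtained by
  swapping the factors.\<close>

lemma integrable_pair:
  assumes [measurable]: "case_prod k \<in> borel_measurable (borel \<Otimes>\<^sub>M borel)"
    and bound: "\<And>x y. 0 < x \<Longrightarrow> 0 < y \<Longrightarrow> \<bar>k x y\<bar> \<le> \<bar>ln x\<bar> + ln (1 + x) + ln (1 + y)"
  shows "integrable (M \<Otimes>\<^sub>M N) (case_prod k)"
    and "0 < y \<Longrightarrow> integrable M (\<lambda>x. k x y)"
proof -
  have 1: "integrable (M \<Otimes>\<^sub>M N) (\<lambda>p. \<bar>ln (fst p)\<bar> + ln (1 + fst p))"
  proof (rule integrable_distr[of fst "M \<Otimes>\<^sub>M N" M "\<lambda>x. \<bar>ln x\<bar> + ln (1 + x)"])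
    show "fst \<in> M \<Otimes>\<^sub>M N \<rightarrow>\<^sub>M M" by measurable
    show "integrable (distr (M \<Otimes>\<^sub>M N) M fst) (\<lambda>x. \<bar>ln x\<bar> + ln (1 + x))"
      unfolding N.distr_pair_fst using M.integrable_ln M.integrable_ln_1p by simp
  qed
  interpret Q: pair_prob_space N M ..
  have "integrable (N \<Otimes>\<^sub>M M) (\<lambda>p. ln (1 + fst p))"
  proof (rule integrable_distr[of fst "N \<Otimes>\<^sub>M M" N "\<lambda>x. ln (1 + x)"])
    show "fst \<in> N \<Otimes>\<^sub>M M \<rightarrow>\<^sub>M N" by measurable
    show "integrable (distr (N \<Otimes>\<^sub>M M) N fst) (\<lambda>x. ln (1 + x))"
      unfolding M.distr_pair_fst by (rule N.integrable_ln_1p)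
  qed
  from Q.integrable_product_swap[OF this]
  have 2: "integrable (M \<Otimes>\<^sub>M N) (\<lambda>p. ln (1 + snd p))" unfolding case_prod_unfold by simp
  have pos: "AE p in M \<Otimes>\<^sub>M N. 0 < fst p \<and> 0 < snd p"
  proof (rule AE_pair_measure)
    show "AE x in M. AE y in N. 0 < fst (x, y) \<and> 0 < snd (x, y)"
      using M.AE_pos by eventually_elim (use N.AE_pos in simp)
  qed measurable
  show "integrable (M \<Otimes>\<^sub>M N) (case_prod k)"
  proof (rule Bochner_Integration.integrable_bound)
    show "integrable (M \<Otimes>\<^sub>M N) (\<lambda>p. (\<bar>ln (fst p)\<bar> + ln (1 + fst p)) + ln (1 + snd p))"
      by (rule Bochner_Integration.integrable_add[OF 1 2])
    show "AE p in M \<Otimes>\<^sub>M N. norm (case_prod k p) \<le>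
        norm ((\<bar>ln (fst p)\<bar> + ln (1 + fst p)) + ln (1 + snd p))"
      using pos by eventually_elim (use bound in \<open>fastforce simp: case_prod_beta\<close>)
  qed measurable
  show "integrable M (\<lambda>x. k x y)" if "0 < y"
  proof (rule Bochner_Integration.integrable_bound)
    show "integrable M (\<lambda>x. \<bar>ln x\<bar> + ln (1 + x) + ln (1 + y))"
      using M.integrable_ln M.integrable_ln_1p by simp
    show "AE x in M. norm (k x y) \<le> norm (\<bar>ln x\<bar> + ln (1 + x) + ln (1 + y))"
      using M.AE_pos by eventually_elim (use bound that in fastforce)
  qed measurable
qed

lemma integrable_ln_kernels:
  shows "integrable (M \<Otimes>\<^sub>M N) (\<lambda>(x, y). ln (1 + x * y))"
    and "integrable (M \<Otimes>\<^sub>M N) (\<lambda>(x, y). ln (x + y + 1))"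
    and "integrable (M \<Otimes>\<^sub>M N) (\<lambda>(x, y). ln (x + y + x * y))"
    and "0 < y \<Longrightarrow> integrable M (\<lambda>x. ln (x + y + 1))"
    and "0 < y \<Longrightarrow> integrable M (\<lambda>x. ln (x + y + x * y))"
proof -
  have weaken: "t \<le> \<bar>ln x\<bar> + ln (1 + x) + ln (1 + y)" if "t \<le> ln (1 + x) + ln (1 + y)" for t x y :: real
    using that by linarith
  note 1 = integrable_pair[of "\<lambda>x y. ln (1 + x * y)", OF _ weaken[OF ln_kernel_bounds(1)]]
    and 2 = integrable_pair[of "\<lambda>x y. ln (x + y + 1)", OF _ weaken[OF ln_kernel_bounds(2)]]
    and 3 = integrable_pair[of "\<lambda>x y. ln (x + y + x * y)", OF _ ln_kernel_bounds(3)]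
  show "integrable (M \<Otimes>\<^sub>M N) (\<lambda>(x, y). ln (1 + x * y))" by (rule 1(1)) measurable
  show "integrable (M \<Otimes>\<^sub>M N) (\<lambda>(x, y). ln (x + y + 1))" by (rule 2(1)) measurable
  show "integrable (M \<Otimes>\<^sub>M N) (\<lambda>(x, y). ln (x + y + x * y))" by (rule 3(1)) measurable
  show "0 < y \<Longrightarrow> integrable M (\<lambda>x. ln (x + y + 1))" by (rule 2(2)) measurable
  show "0 < y \<Longrightarrow> integrable M (\<lambda>x. ln (x + y + x * y))" by (rule 3(2)) measurable
qed

text \<open>For fixed \<open>y\<close> the invariance of \<open>M\<close> is used in
  \<open>x\<close>, and Fubini integrates the result over \<open>y\<close>. The subtracted integrals
  come from the denominators \<open>x\<close> and \<open>1 + x\<close> of the two maps.\<close>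

lemma integral_ln_kernel_split:
  "(\<integral>(x, y). ln (1 + x * y) \<partial>(M \<Otimes>\<^sub>M N)) =
    \<beta> * ((\<integral>(x, y). ln (x + y + x * y) \<partial>(M \<Otimes>\<^sub>M N)) - (\<integral>x. ln x \<partial>M)) +
    (1 - \<beta>) * ((\<integral>(x, y). ln (x + y + 1) \<partial>(M \<Otimes>\<^sub>M N)) - (\<integral>x. ln (1 + x) \<partial>M))"
proof -
  let ?g = "\<integral>x. ln x \<partial>M" and ?L = "\<integral>x. ln (1 + x) \<partial>M"
  have inner: "(\<integral>x. ln (1 + x * y) \<partial>M) =
      \<beta> * ((\<integral>x. ln (x + y + x * y) \<partial>M) - ?g) + (1 - \<beta>) * ((\<integral>x. ln (x + y + 1) \<partial>M) - ?L)"
    if y: "0 < y" for y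
  proof -
    have R: "AE x in M. ln (x + y + x * y) - ln x = ln (1 + (1 + 1 / x) * y)"
      using M.AE_pos
    proof eventually_elim
      case (elim x)
      then have "1 + (1 + 1 / x) * y = (x + y + x * y) / x" by (simp add: field_simps)
      moreover have "0 < x + y + x * y" using elim y by (simp add: add_pos_pos)
      ultimately show ?case using elim by (simp add: ln_div)
    qed
    have Q: "AE x in M. ln (x + y + 1) - ln (1 + x) = ln (1 + 1 / (1 + x) * y)"
      using M.AE_pos
    proof eventually_elim
      case (elim x)
      then have "1 + 1 / (1 + x) * y = (x + y + 1) / (1 + x)" by (simp add: field_simps)
      then show ?case using elim y by (simp add: ln_div)
    qed
    note i = integrable_ln_kernels(4,5)[OF y]
    have iR: "integrable M (\<lambda>x. ln (1 + (1 + 1 / x) * y))"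
      using Bochner_Integration.integrable_diff[OF i(2) M.integrable_ln]
      by (rule integrable_cong_AE_imp[OF _ _ R]) measurable
    have iQ: "integrable M (\<lambda>x. ln (1 + 1 / (1 + x) * y))"
      using Bochner_Integration.integrable_diff[OF i(1) M.integrable_ln_1p]
      by (rule integrable_cong_AE_imp[OF _ _ Q]) measurable
    have "(\<integral>x. ln (1 + (1 + 1 / x) * y) \<partial>M) = (\<integral>x. ln (x + y + x * y) - ln x \<partial>M)"
      using R by (intro integral_cong_AE) auto
    moreover have "(\<integral>x. ln (1 + 1 / (1 + x) * y) \<partial>M) = (\<integral>x. ln (x + y + 1) - ln (1 + x) \<partial>M)"
      using Q by (intro integral_cong_AE) auto
    ultimately show ?thesis
      using M.integral_split[OF _ iR iQ] i M.integrable_ln M.integrable_ln_1p by simp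
  qed
  note fubini = integral_snd[OF integrable_ln_kernels(1)]
    integral_snd[OF integrable_ln_kernels(2)] integral_snd[OF integrable_ln_kernels(3)]
  have [simp]: "integrable N (\<lambda>y. \<integral>x. ln (x + y + 1) \<partial>M)"
    "integrable N (\<lambda>y. \<integral>x. ln (x + y + x * y) \<partial>M)"
    by (rule integrable_snd[OF integrable_ln_kernels(2)] integrable_snd[OF integrable_ln_kernels(3)])+
  have "(\<integral>(x, y). ln (1 + x * y) \<partial>(M \<Otimes>\<^sub>M N)) = (\<integral>y. \<beta> * ((\<integral>x. ln (x + y + x * y) \<partial>M) - ?g) +
      (1 - \<beta>) * ((\<integral>x. ln (x + y + 1) \<partial>M) - ?L) \<partial>N)"
    unfolding fubini(1)[symmetric]
    using N.AE_pos by (intro integral_cong_AE, measurable, eventually_elim) (rule inner)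
  also have "\<dots> = \<beta> * ((\<integral>y. \<integral>x. ln (x + y + x * y) \<partial>M \<partial>N) - ?g) +
      (1 - \<beta>) * ((\<integral>y. \<integral>x. ln (x + y + 1) \<partial>M \<partial>N) - ?L)"
    by (simp add: N.prob_space)
  finally show ?thesis unfolding fubini(2,3) .
qed

lemma integrable_ratio_kernel:
  shows "integrable (M \<Otimes>\<^sub>M N) (\<lambda>(x, y). ln ((x + y + x * y) / (x + y + 1)))"
    and "(\<integral>(x, y). ln ((x + y + x * y) / (x + y + 1)) \<partial>(M \<Otimes>\<^sub>M N)) =
      (\<integral>(x, y). ln (x + y + x * y) \<partial>(M \<Otimes>\<^sub>M N)) - (\<integral>(x, y). ln (x + y + 1) \<partial>(M \<Otimes>\<^sub>M N))"
proof -
  have "AE p in M \<Otimes>\<^sub>M N. 0 < fst p \<and> 0 < snd p"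
  proof (rule AE_pair_measure)
    show "AE x in M. AE y in N. 0 < fst (x, y) \<and> 0 < snd (x, y)"
      using M.AE_pos by eventually_elim (use N.AE_pos in simp)
  qed measurable
  then have eq: "AE p in M \<Otimes>\<^sub>M N. (\<lambda>(x, y). ln (x + y + x * y)) p - (\<lambda>(x, y). ln (x + y + 1)) p =
      (\<lambda>(x, y). ln ((x + y + x * y) / (x + y + 1))) p"
  proof eventually_elim
    case (elim p)
    then have "0 < fst p + snd p + fst p * snd p" "0 < fst p + snd p + 1"
      by (auto intro!: add_pos_pos)
    then show ?case by (simp add: case_prod_beta ln_div)
  qed
  note i = Bochner_Integration.integrable_diff[OF integrable_ln_kernels(3,2)]
  show "integrable (M \<Otimes>\<^sub>M N) (\<lambda>(x, y). ln ((x + y + x * y) / (x + y + 1)))"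
    using i by (rule integrable_cong_AE_imp[OF _ _ eq]) measurable
  show "(\<integral>(x, y). ln ((x + y + x * y) / (x + y + 1)) \<partial>(M \<Otimes>\<^sub>M N)) =
      (\<integral>(x, y). ln (x + y + x * y) \<partial>(M \<Otimes>\<^sub>M N)) - (\<integral>(x, y). ln (x + y + 1) \<partial>(M \<Otimes>\<^sub>M N))"
    unfolding Bochner_Integration.integral_diff[OF integrable_ln_kernels(3,2), symmetric]
    by (rule integral_cong_AE) (measurable, use eq in \<open>auto simp: eq_commute\<close>)
qed

end

text \<open>
  \<open>ln (1 + x y)\<close> is symmetric, and both maps act on its first and its second argument in the same
  way up to terms depending on one variable: \<open>1 + (1 + 1/x) y = (x + y + x y) / x\<close> and
  \<open>1 + y / (1 + x) = (x + y + 1) / (1 + x)\<close>. Using invariance in either variable gives two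
  expressions for one integral.
\<close>

lemma mean_ln_denominator_diff:
  assumes "stationary_law M \<beta>" "stationary_law N \<alpha>"
  shows "(\<beta> * (\<integral>x. ln x \<partial>M) + (1 - \<beta>) * (\<integral>x. ln (1 + x) \<partial>M)) -
      (\<alpha> * (\<integral>x. ln x \<partial>N) + (1 - \<alpha>) * (\<integral>x. ln (1 + x) \<partial>N)) =
    (\<beta> - \<alpha>) * (\<integral>(x, y). ln ((x + y + x * y) / (x + y + 1)) \<partial>(M \<Otimes>\<^sub>M N))"
proof -
  interpret M: stationary_law M \<beta> by fact
  interpret N: stationary_law N \<alpha> by fact
  interpret P: stationary_pair M \<beta> N \<alpha> ..
  interpret Q: stationary_pair N \<alpha> M \<beta> ..
  have swap: "(\<integral>(x, y). ln (1 + x * y) \<partial>(N \<Otimes>\<^sub>M M)) = (\<integral>(x, y). ln (1 + x * y) \<partial>(M \<Otimes>\<^sub>M N))"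
    "(\<integral>(x, y). ln (x + y + x * y) \<partial>(N \<Otimes>\<^sub>M M)) = (\<integral>(x, y). ln (x + y + x * y) \<partial>(M \<Otimes>\<^sub>M N))"
    "(\<integral>(x, y). ln (x + y + 1) \<partial>(N \<Otimes>\<^sub>M M)) = (\<integral>(x, y). ln (x + y + 1) \<partial>(M \<Otimes>\<^sub>M N))"
    using P.integral_product_swap[OF borel_measurable_integrable[OF P.integrable_ln_kernels(1)]]
      P.integral_product_swap[OF borel_measurable_integrable[OF P.integrable_ln_kernels(2)]]
      P.integral_product_swap[OF borel_measurable_integrable[OF P.integrable_ln_kernels(3)]]
    by (simp_all add: ac_simps)
  show ?thesis
    using P.integral_ln_kernel_split Q.integral_ln_kernel_split
    unfolding swap P.integrable_ratio_kernel(2) by algebra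
qed

subsection \<open>The derivative\<close>

context stationary_law
begin

text \<open>This is the inner integral of the ratio kernel as a function of
  \<open>t = x/(1+x)\<close>, with numerator and denominator both divided by \<open>1 + x\<close>.
  In this form it makes sense up to the endpoints of \<open>[0,1]\<close>.\<close>

definition section_integral :: "real \<Rightarrow> real" where
  "section_integral t = (\<integral>y. ln (t + y) - ln (1 + y * (1 - t)) \<partial>M)"

text \<open>Dominated convergence applies with one bound for all \<open>t\<close>:
  \<open>ln (t + y)\<close> lies between \<open>ln y\<close> and \<open>ln (1 + y)\<close>, and the
  other logarithm between 0 and \<open>ln (1 + y)\<close>.\<close>

lemma continuous_on_section_integral: "continuous_on {0..1} section_integral"
  unfolding continuous_on_sequentially
proof (intro allI ballI impI, elim conjE)
  fix u :: "nat \<Rightarrow> real" and t :: real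
  assume t: "t \<in> {0..1}" and u: "\<forall>n. u n \<in> {0..1}" and lim: "u \<longlonglongrightarrow> t"
  show "(section_integral \<circ> u) \<longlonglongrightarrow> section_integral t"
    unfolding comp_def section_integral_def
  proof (rule integral_dominated_convergence)
    show "integrable M (\<lambda>y. \<bar>ln y\<bar> + 2 * ln (1 + y))"
      using integrable_ln integrable_ln_1p by simp
    show "AE y in M. (\<lambda>n. ln (u n + y) - ln (1 + y * (1 - u n))) \<longlonglongrightarrow> ln (t + y) - ln (1 + y * (1 - t))"
      using AE_pos
    proof eventually_elim
      case (elim y)
      have "0 < t + y" "0 < 1 + y * (1 - t)" using t elim by (auto intro!: add_pos_nonneg)
      then show ?case using lim by (intro tendsto_intros) auto
    qed
    show "AE y in M. norm (ln (u n + y) - ln (1 + y * (1 - u n))) \<le> \<bar>ln y\<bar> + 2 * ln (1 + y)" for n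
      using AE_pos
    proof eventually_elim
      case (elim y)
      have un: "0 \<le> u n" "u n \<le> 1" using u by auto
      have "y * (1 - u n) \<le> y * 1" "0 \<le> y * (1 - u n)"
        using elim un by (intro mult_left_mono mult_nonneg_nonneg; simp)+
      then have "0 \<le> ln (1 + y * (1 - u n))" "ln (1 + y * (1 - u n)) \<le> ln (1 + y)"
        using elim by auto
      moreover have "ln y \<le> ln (u n + y)" "ln (u n + y) \<le> ln (1 + y)"
        using elim un by auto
      ultimately show ?case unfolding real_norm_def by linarith
    qed
  qed measurable
qed

lemma section_integral_eq:
  assumes x: "0 < x"
  shows "(\<integral>y. ln ((x + y + x * y) / (x + y + 1)) \<partial>M) = section_integral (x / (1 + x))"
  unfolding section_integral_def
proof (rule integral_cong_AE)
  show "AE y in M. ln ((x + y + x * y) / (x + y + 1)) =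
      ln (x / (1 + x) + y) - ln (1 + y * (1 - x / (1 + x)))"
    using AE_pos
  proof eventually_elim
    case (elim y)
    have "x / (1 + x) + y = (x + y + x * y) / (1 + x)"
      "1 + y * (1 - x / (1 + x)) = (x + y + 1) / (1 + x)"
      using x by (simp_all add: field_simps)
    moreover have "0 < x + y + x * y" using x elim by (simp add: add_pos_pos)
    ultimately show ?case using x elim by (simp add: ln_div)
  qed
qed measurable

end

text \<open>Weak continuity for test functions continuous on the compactified half-line. Uniform
  continuity fixes \<open>n\<close> from \<open>e\<close> alone, after which the error proportional
  to \<open>\<bar>\<beta> - \<alpha>\<bar>\<close> tends to 0.\<close>

lemma tendsto_integral_nu:
  fixes g h :: "real \<Rightarrow> real"
  assumes \<alpha>: "\<alpha> \<in> {0..1}" and h [measurable]: "h \<in> borel_measurable borel"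
    and g: "continuous_on {0..1} g" and hg: "\<And>x. 0 < x \<Longrightarrow> h x = g (x / (1 + x))"
  shows "((\<lambda>\<beta>. \<integral>x. h x \<partial>nu \<beta>) \<longlongrightarrow> (\<integral>x. h x \<partial>nu \<alpha>)) (at \<alpha> within {0..1})"
proof (rule tendstoI)
  fix e :: real assume e: "0 < e"
  have "bounded (g ` {0..1})"
    by (intro compact_imp_bounded compact_continuous_image g) auto
  then obtain C where C: "C > 0" "\<And>t. t \<in> {0..1} \<Longrightarrow> \<bar>g t\<bar> \<le> C"
    by (auto simp: bounded_pos)
  have "uniformly_continuous_on {0..1} g" by (intro compact_uniformly_continuous g) auto
  then obtain d where d: "d > 0"
    "\<And>s t. s \<in> {0..1} \<Longrightarrow> t \<in> {0..1} \<Longrightarrow> dist s t < d \<Longrightarrow> dist (g s) (g t) < e / 2"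
    using e unfolding uniformly_continuous_on_def by (metis half_gt_zero)
  obtain n where n: "1 / real (Suc n) < d" using nat_approx_posE[OF d(1)] by blast
  have tau: "x / (1 + x) \<in> {0..1}" if "0 < x" for x :: real using that by auto
  have *: "\<bar>(\<integral>x. h x \<partial>nu \<beta>) - (\<integral>x. h x \<partial>nu \<alpha>)\<bar> \<le> e / 2 + real n * (2 * C * \<bar>\<beta> - \<alpha>\<bar>)"
    if "\<beta> \<in> {0..1}" for \<beta>
  proof (rule stationary_law_integral_diff)
    show "stationary_law (nu \<beta>) \<beta>" "stationary_law (nu \<alpha>) \<alpha>"
      using \<alpha> that by (auto intro: stationary_law_nu)
    show "\<bar>h x\<bar> \<le> C" if "0 < x" for x using C(2)[OF tau[OF that]] hg[OF that] by simp
    show "\<bar>h x - h y\<bar> \<le> e / 2"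
      if "0 < x" "0 < y" "\<bar>x / (1 + x) - y / (1 + y)\<bar> \<le> 1 / real (Suc n)" for x y
      using d(2)[OF tau[OF that(1)] tau[OF that(2)]] that(3) n
      by (simp add: hg[OF that(1)] hg[OF that(2)] dist_real_def)
  qed measurable
  have "((\<lambda>\<beta>. e / 2 + real n * (2 * C * \<bar>\<beta> - \<alpha>\<bar>)) \<longlongrightarrow> e / 2 + real n * (2 * C * \<bar>\<alpha> - \<alpha>\<bar>))
      (at \<alpha> within {0..1})"
    by (intro tendsto_intros)
  from order_tendstoD(2)[OF this, of e] have "\<forall>\<^sub>F \<beta> in at \<alpha> within {0..1}. e / 2 + real n * (2 * C * \<bar>\<beta> - \<alpha>\<bar>) < e"
    using e by simp
  moreover have "\<forall>\<^sub>F \<beta> in at \<alpha> within {0..1}. \<beta> \<in> {0..1}"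
    by (auto simp: eventually_at_filter)
  ultimately show "\<forall>\<^sub>F \<beta> in at \<alpha> within {0..1}. dist (\<integral>x. h x \<partial>nu \<beta>) (\<integral>x. h x \<partial>nu \<alpha>) < e"
    by eventually_elim (use * in \<open>fastforce simp: dist_real_def\<close>)
qed

text \<open>The expected logarithm of the denominator of the chosen map: \<open>x\<close> with
  probability \<open>\<alpha>\<close>, \<open>1 + x\<close> with probability
  \<open>1 - \<alpha>\<close>.\<close>

definition mean_ln_denominator :: "real \<Rightarrow> real" where
  "mean_ln_denominator \<alpha> = \<alpha> * gamma \<alpha> + (1 - \<alpha>) * (\<integral>x. ln (1 + x) \<partial>nu \<alpha>)"

text \<open>The difference quotient is exactly the integral of the fixed function \<open>H\<close>
  against \<open>nu \<beta>\<close>, so only weak convergence of \<open>nu \<beta>\<close> is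
  needed.\<close>

lemma mean_ln_denominator_derivative:
  assumes \<alpha>: "\<alpha> \<in> {0..1}"
  shows "(mean_ln_denominator has_real_derivative
      (\<integral>(x, y). ln ((x + y + x * y) / (x + y + 1)) \<partial>(nu \<alpha> \<Otimes>\<^sub>M nu \<alpha>))) (at \<alpha> within {0..1})"
proof -
  interpret A: stationary_law "nu \<alpha>" \<alpha> using \<alpha> by (auto intro: stationary_law_nu)
  define H where "H x = (\<integral>y. ln ((x + y + x * y) / (x + y + 1)) \<partial>nu \<alpha>)" for x
  have [measurable]: "H \<in> borel_measurable borel" unfolding H_def by measurable
  have fubini: "(\<integral>(x, y). ln ((x + y + x * y) / (x + y + 1)) \<partial>(nu \<beta> \<Otimes>\<^sub>M nu \<alpha>)) = (\<integral>x. H x \<partial>nu \<beta>)"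
    if "\<beta> \<in> {0..1}" for \<beta>
  proof -
    interpret stationary_law "nu \<beta>" \<beta> using that by (auto intro: stationary_law_nu)
    interpret stationary_pair "nu \<beta>" \<beta> "nu \<alpha>" \<alpha> ..
    show ?thesis unfolding H_def by (rule integral_fst[symmetric]) (rule integrable_ratio_kernel(1))
  qed
  have slope: "(mean_ln_denominator \<beta> - mean_ln_denominator \<alpha>) / (\<beta> - \<alpha>) = (\<integral>x. H x \<partial>nu \<beta>)"
    if "\<beta> \<in> {0..1}" "\<beta> \<noteq> \<alpha>" for \<beta>
    using mean_ln_denominator_diff[OF stationary_law_nu stationary_law_nu, of \<beta> \<alpha>] fubini[of \<beta>] that \<alpha>
    by (simp add: mean_ln_denominator_def gamma_def)
  have "((\<lambda>\<beta>. \<integral>x. H x \<partial>nu \<beta>) \<longlongrightarrow> (\<integral>x. H x \<partial>nu \<alpha>)) (at \<alpha> within {0..1})"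
    by (rule tendsto_integral_nu[OF \<alpha> _ A.continuous_on_section_integral])
      (auto simp: H_def[symmetric] A.section_integral_eq[folded H_def])
  moreover have "\<forall>\<^sub>F \<beta> in at \<alpha> within {0..1}.
      (\<integral>x. H x \<partial>nu \<beta>) = (mean_ln_denominator \<beta> - mean_ln_denominator \<alpha>) / (\<beta> - \<alpha>)"
    using slope by (auto simp: eventually_at_filter)
  ultimately have "((\<lambda>\<beta>. (mean_ln_denominator \<beta> - mean_ln_denominator \<alpha>) / (\<beta> - \<alpha>)) \<longlongrightarrow> (\<integral>x. H x \<partial>nu \<alpha>))
      (at \<alpha> within {0..1})"
    by (rule Lim_transform_eventually)
  then show ?thesis unfolding has_field_derivative_iff fubini[OF \<alpha>] .
qed

lemma quadratic_nonzero: "\<alpha>\<^sup>2 - \<alpha> + 1 \<noteq> (0::real)"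
proof -
  have "\<alpha>\<^sup>2 - \<alpha> + 1 = (\<alpha> - 1 / 2)\<^sup>2 + 3 / 4" by (simp add: power2_eq_square algebra_simps)
  then show ?thesis using zero_le_power2[of "\<alpha> - 1 / 2"] by linarith
qed

text \<open>\<open>ln_balance\<close> eliminates the integral of \<open>ln (1 + x)\<close>; the
  quadratic arises as \<open>\<alpha> * (2 * \<alpha> - 1) + (1 - \<alpha>) * (1 +
  \<alpha>)\<close>.\<close>

lemma gamma_eq_mean_ln_denominator:
  assumes \<alpha>: "\<alpha> \<in> {0..1}"
  shows "gamma \<alpha> = mean_ln_denominator \<alpha> * ((2 * \<alpha> - 1) / (\<alpha>\<^sup>2 - \<alpha> + 1))"
proof -
  interpret stationary_law "nu \<alpha>" \<alpha> using \<alpha> by (auto intro: stationary_law_nu)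
  have "(\<alpha>\<^sup>2 - \<alpha> + 1) * gamma \<alpha> = (2 * \<alpha> - 1) * mean_ln_denominator \<alpha>"
    using ln_balance unfolding mean_ln_denominator_def gamma_def by algebra
  then show ?thesis using quadratic_nonzero[of \<alpha>] by (simp add: field_simps)
qed

theorem proposition4p5:
  fixes \<alpha> :: real
  assumes "1 / 2 < \<alpha>" and "\<alpha> \<le> 1"
  shows "(gamma has_real_derivative
           gamma \<alpha> * ((1 + 2 * \<alpha> - 2 * \<alpha>\<^sup>2) / ((2 * \<alpha> - 1) * (\<alpha>\<^sup>2 - \<alpha> + 1)))
           + (2 * \<alpha> - 1) / (\<alpha>\<^sup>2 - \<alpha> + 1) *
             (\<integral>(x, y). ln ((x + y + x * y) / (x + y + 1)) \<partial>(nu \<alpha> \<Otimes>\<^sub>M nu \<alpha>)))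
         (at \<alpha> within {0..1})"
proof -
  have \<alpha>: "\<alpha> \<in> {0..1}" using assms by simp
  let ?I = "\<integral>(x, y). ln ((x + y + x * y) / (x + y + 1)) \<partial>(nu \<alpha> \<Otimes>\<^sub>M nu \<alpha>)"
  define c where "c = \<alpha>\<^sup>2 - \<alpha> + 1"
  have c: "c \<noteq> 0" unfolding c_def by (rule quadratic_nonzero)
  have "((\<lambda>\<beta>. (2 * \<beta> - 1) / (\<beta>\<^sup>2 - \<beta> + 1)) has_real_derivative
      (2 * c - (2 * \<alpha> - 1) * (2 * \<alpha> - 1)) / (c * c)) (at \<alpha> within {0..1})"
    using c unfolding c_def by (auto intro!: derivative_eq_intros simp: power2_eq_square)
  from DERIV_mult[OF mean_ln_denominator_derivative[OF \<alpha>] this]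
  have deriv: "((\<lambda>\<beta>. mean_ln_denominator \<beta> * ((2 * \<beta> - 1) / (\<beta>\<^sup>2 - \<beta> + 1))) has_real_derivative
      ?I * ((2 * \<alpha> - 1) / c) +
      (2 * c - (2 * \<alpha> - 1) * (2 * \<alpha> - 1)) / (c * c) * mean_ln_denominator \<alpha>) (at \<alpha> within {0..1})"
    by (simp add: c_def)
  \<comment> \<open>Here \<open>\<alpha> > 1/2\<close> permits division by
    \<open>2 * \<alpha> - 1\<close>.\<close>
  have "mean_ln_denominator \<alpha> = gamma \<alpha> * (c / (2 * \<alpha> - 1))"
    using gamma_eq_mean_ln_denominator[OF \<alpha>] c assms(1) by (simp add: c_def[symmetric])
  moreover have "2 * c - (2 * \<alpha> - 1) * (2 * \<alpha> - 1) = 1 + 2 * \<alpha> - 2 * \<alpha>\<^sup>2"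
    by (simp add: c_def power2_eq_square algebra_simps)
  ultimately have "(2 * c - (2 * \<alpha> - 1) * (2 * \<alpha> - 1)) / (c * c) * mean_ln_denominator \<alpha> =
      gamma \<alpha> * ((1 + 2 * \<alpha> - 2 * \<alpha>\<^sup>2) / ((2 * \<alpha> - 1) * c))"
    using c by (simp add: mult.commute)
  with deriv have "((\<lambda>\<beta>. mean_ln_denominator \<beta> * ((2 * \<beta> - 1) / (\<beta>\<^sup>2 - \<beta> + 1))) has_real_derivative
      gamma \<alpha> * ((1 + 2 * \<alpha> - 2 * \<alpha>\<^sup>2) / ((2 * \<alpha> - 1) * (\<alpha>\<^sup>2 - \<alpha> + 1)))
      + (2 * \<alpha> - 1) / (\<alpha>\<^sup>2 - \<alpha> + 1) * ?I) (at \<alpha> within {0..1})"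
    by (simp add: c_def add.commute mult.commute)
  \<comment> \<open>The product formula for \<open>gamma\<close> holds on all of
    \<open>{0..1}\<close>, so the derivative within that set carries over, as a left derivative when
    \<open>\<alpha> = 1\<close>.\<close>
  then show ?thesis
    by (rule has_field_derivative_transform_within[OF _ zero_less_one \<alpha>])
      (simp add: gamma_eq_mean_ln_denominator)
qed

end
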